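(* Let $A, B \in \mathcal{S}$ (standard generating sets) and suppose they have the same signature, i.e. $|A|=|B|$ and the order-preserving bijection $\theta: A\to B$ (with respect to the orders $<$ on $A$ and $B$) satisfies $o(\theta(f),\theta(g)) = o(f,g)$ for all $f<g$ in $A$. Then $\theta$ extends to a group isomorphism from $\langle A\rangle$ to $\langle B\rangle$.
   Context: $\mathrm{Homeo}_+(I)$ is the group of orientation-preserving homeomorphisms of $I=[0,1]$, acting on the right ($t\mapsto tf$) and composed left to right; $f^g = g^{-1}fg$. The support of $f$ is $\mathrm{supt}(f)=\{t: tf\neq t\}$; its extended support is the interior of the closure of $\mathrm{supt}(f)$. An orbital of $f$ is a connected component of $\mathrm{supt}(f)$; endpoints of orbitals are transition points of $f$. A bump is an element with exactly one orbital; it is positive if $tf>t$ on its orbital, negative otherwise. If $J$ is an orbital of $g$, the bump of $g$ on $J$ agrees with $g$ on $J$ and is the identity elsewhere. A marking of a set of bumps assigns to each bump $a$ with support $(u,v)$ a point $s_a\in(u,v)$; the feet of $a$ are $(u,s_a)$ and $[t_a,v)$ where $t_a=s_a a$ if $a$ is positive and $t_a=s_a a^{-1}$ if $a$ is negative. A marked function is an element of $\mathrm{Homeo}_+(I)$ with finitely many bumps together with a marking of its bumps. A finite set $S$ of marked functions is fast if no bump occurs in two different elements of $S$ and distinct bumps occurring in $S$ have disjoint feet. A standard function is a marked function $f$ whose extended support is an interval, all of whose positive bumps lie to the right of all its negative bumps, and whose number of positive bumps equals or exceeds by one its number of negative bumps. For standard $f,g$: $f\ll g$ means their extended supports are disjoint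 with that of $f$ to the left; $f\sqsubset g$ means the closure of the extended support of $f$ lies in the extended support of $g$; $f<g$ means $f\ll g$ or $f\sqsubset g$. For standard $f$, $f^\circ$ is defined as follows: if $f$ has more than two orbitals, $f^\circ$ agrees with $f$ on the union of all orbitals of $f$ other than its leftmost and rightmost, is the identity elsewhere, and keeps the markers of $f$; if $f$ has one or two orbitals and the left foot of its positive bump is $(r,s)$, $f^\circ$ is a positive bump with support $(r,s)$ and arbitrary marker. A pair $(f,g)$ of standard functions is a standard pair if $\{f,g\}$ is fast and either $f\ll g$, or $f\sqsubset g$ and $(g^\circ,f)$ is a standard pair (recursive definition). $\mathcal{S}$ is the collection of finite sets $A$ of standard functions such that any two distinct elements of $A$ are $<$-comparable and, written $f<g$, form a standard pair. For a fast pair $f<g$ of marked functions, the oscillation $o(f,g)$ is the number of orbitals of $g$ containing at least one transition point of $f$. *)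

theory Defs
  imports "HOL-Analysis.Analysis" "HOL-Algebra.Generated_Groups"
begin

definition homeo :: "(real \<Rightarrow> real) \<Rightarrow> bool" where
  "homeo f \<longleftrightarrow> (\<exists>g. homeomorphism {0..1} {0..1} f g) \<and> mono_on {0..1} f
      \<and> (\<forall>t. t \<notin> {0..1} \<longrightarrow> f t = t)"

text \<open>Product f g means: first apply f, then g (t (fg) = (t f) g).\<close>
definition Homeo :: "(real \<Rightarrow> real) monoid" where
  "Homeo = \<lparr>carrier = {f. homeo f}, mult = (\<lambda>f g. g \<circ> f), one = id\<rparr>"

definition supt :: "(real \<Rightarrow> real) \<Rightarrow> real set" where
  "supt f = {t \<in> {0..1}. f t \<noteq> t}"

definition ext_supt :: "(real \<Rightarrow> real) \<Rightarrow> real set" where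
  "ext_supt f = interior (closure (supt f))"

definition orbitals :: "(real \<Rightarrow> real) \<Rightarrow> (real \<times> real) set" where
  "orbitals f = {(u,v). u < v \<and> {u<..<v} \<in> components (supt f)}"

definition trans_pts :: "(real \<Rightarrow> real) \<Rightarrow> real set" where
  "trans_pts f = {p. \<exists>u v. (u,v) \<in> orbitals f \<and> (p = u \<or> p = v)}"

definition bump_on :: "(real \<Rightarrow> real) \<Rightarrow> real \<times> real \<Rightarrow> (real \<Rightarrow> real)" where
  "bump_on f J = (\<lambda>t. if fst J < t \<and> t < snd J then f t else t)"

definition positive_on :: "(real \<Rightarrow> real) \<Rightarrow> real \<times> real \<Rightarrow> bool" where
  "positive_on f J \<longleftrightarrow> (\<forall>t. fst J < t \<and> t < snd J \<longrightarrow> f t > t)"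

definition pos_orbitals :: "(real \<Rightarrow> real) \<Rightarrow> (real \<times> real) set" where
  "pos_orbitals f = {J \<in> orbitals f. positive_on f J}"

definition neg_orbitals :: "(real \<Rightarrow> real) \<Rightarrow> (real \<times> real) set" where
  "neg_orbitals f = {J \<in> orbitals f. \<not> positive_on f J}"

text \<open>A marked function is a pair (f, m): f an element of Homeo_+(I) with finitely many bumps,
  and m assigns to each orbital (u,v) of f (i.e. to each bump) its marker m (u,v) in (u,v).\<close>
type_synonym mfun = "(real \<Rightarrow> real) \<times> (real \<times> real \<Rightarrow> real)"

definition marked :: "mfun \<Rightarrow> bool" where
  "marked F \<longleftrightarrow> homeo (fst F) \<and> finite (orbitals (fst F))
     \<and> (\<forall>u v. (u,v) \<in> orbitals (fst F) \<longrightarrow> u < snd F (u,v) \<and> snd F (u,v) < v)"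

definition rfoot_start :: "mfun \<Rightarrow> real \<times> real \<Rightarrow> real" where
  "rfoot_start F J = (if positive_on (fst F) J then fst F (snd F J)
                      else the_inv_into {0..1} (fst F) (snd F J))"

definition feet :: "mfun \<Rightarrow> real \<times> real \<Rightarrow> real set" where
  "feet F J = {fst J<..<snd F J} \<union> {rfoot_start F J..<snd J}"

definition fast :: "mfun set \<Rightarrow> bool" where
  "fast S \<longleftrightarrow> finite S \<and> (\<forall>F\<in>S. marked F)
     \<and> (\<forall>F\<in>S. \<forall>G\<in>S. \<forall>J\<in>orbitals (fst F). \<forall>K\<in>orbitals (fst G).
           F \<noteq> G \<longrightarrow> bump_on (fst F) J \<noteq> bump_on (fst G) K)
     \<and> (\<forall>F\<in>S. \<forall>G\<in>S. \<forall>J\<in>orbitals (fst F). \<forall>K\<in>orbitals (fst G).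
           bump_on (fst F) J \<noteq> bump_on (fst G) K \<longrightarrow> feet F J \<inter> feet G K = {})"

definition standard :: "mfun \<Rightarrow> bool" where
  "standard F \<longleftrightarrow> marked F
     \<and> (\<exists>a b. a < b \<and> ext_supt (fst F) = {a<..<b})
     \<and> (\<forall>J\<in>pos_orbitals (fst F). \<forall>K\<in>neg_orbitals (fst F). snd K \<le> fst J)
     \<and> (card (pos_orbitals (fst F)) = card (neg_orbitals (fst F))
        \<or> card (pos_orbitals (fst F)) = card (neg_orbitals (fst F)) + 1)"

definition ll :: "mfun \<Rightarrow> mfun \<Rightarrow> bool" where
  "ll F G \<longleftrightarrow> (\<forall>x\<in>ext_supt (fst F). \<forall>y\<in>ext_supt (fst G). x < y)"

definition sqsub :: "mfun \<Rightarrow> mfun \<Rightarrow> bool" where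
  "sqsub F G \<longleftrightarrow> closure (ext_supt (fst F)) \<subseteq> ext_supt (fst G)"

definition lt :: "mfun \<Rightarrow> mfun \<Rightarrow> bool" where
  "lt F G \<longleftrightarrow> ll F G \<or> sqsub F G"

text \<open>circ G H: H is an admissible choice of G\<degree> (the one-or-two-orbital case allows an
  arbitrary positive bump with the prescribed support and an arbitrary marker).\<close>
definition circ :: "mfun \<Rightarrow> mfun \<Rightarrow> bool" where
  "circ G H \<longleftrightarrow>
    (if card (orbitals (fst G)) > 2 then
       (let inner = {J \<in> orbitals (fst G). (\<exists>K\<in>orbitals (fst G). fst K < fst J)
                                         \<and> (\<exists>K\<in>orbitals (fst G). fst J < fst K)}
        in fst H = (\<lambda>t. if t \<in> (\<Union>J\<in>inner. {fst J<..<snd J}) then fst G t else t)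
           \<and> snd H = snd G)
     else
       (\<exists>J\<in>pos_orbitals (fst G).
          marked H \<and> supt (fst H) = {fst J<..<snd G J}
          \<and> positive_on (fst H) (fst J, snd G J)))"

inductive std_pair :: "mfun \<Rightarrow> mfun \<Rightarrow> bool" where
  ll_case: "\<lbrakk>standard F; standard G; fast {F, G}; ll F G\<rbrakk> \<Longrightarrow> std_pair F G"
| sq_case: "\<lbrakk>standard F; standard G; fast {F, G}; sqsub F G; circ G H; std_pair H F\<rbrakk>
              \<Longrightarrow> std_pair F G"

definition std_sets :: "mfun set set" where
  "std_sets = {A. finite A \<and> (\<forall>F\<in>A. standard F)
      \<and> (\<forall>F\<in>A. \<forall>G\<in>A. F \<noteq> G \<longrightarrow> lt F G \<or> lt G F)
      \<and> (\<forall>F\<in>A. \<forall>G\<in>A. F \<noteq> G \<longrightarrow> lt F G \<longrightarrow> std_pair F G)}"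

definition osc :: "mfun \<Rightarrow> mfun \<Rightarrow> nat" where
  "osc F G = card {J \<in> orbitals (fst G). \<exists>p\<in>trans_pts (fst F). fst J < p \<and> p < snd J}"

end

theory Submission
  imports Defs
begin

text \<open>The feet of a fast set of bumps play ping-pong: a bump maps every point of its support outside
  its source foot into its destination foot, so a point is described by the stack of feet through
  which it can be pulled back, and a generator acts on such stacks by pushing or popping one foot.
  A word that fixes all points with long stacks is trivial: the orbit of any other point stays over
  one base point with bounded stack height, hence is finite, whereas a monotone map moves a point
  along an infinite orbit. Therefore a word is trivial iff it fixes all long stacks, which only
  depends on which foot lies in which bump.

  For a standard pair the recursion defining it forces the transition points of the two functions
  to interlace from the outside inwards, to a depth that equals the oscillation. So the oscillations
  determine the position of the outer feet. The remaining inner bumps of a function contain no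
  transition points of other functions, and their number is not determined by the signature; but
  their feet lie in the same bumps of the other functions as the foot at the left end of the adjacent
  outer bump. That foot repels, so a stack over an attracting inner foot is simulated by a stack over
  it with the counter running backwards.\<close>

section \<open>Ping-pong systems and stacks of feet\<close>

text \<open>Functions that correspond under equal signatures may have different numbers of bumps, so
  in general their feet cannot be matched one to one. What can be compared is which words are
  trivial, and long stacks reduce that to bookkeeping with labels. Inner feet can be replaced
  because they occur only as one run at the bottom of a stack: a push by another generator enters a
  bump containing a transition point, hence an outer bump, while a push by the same letter repeats
  the foot. The first outer bump to the right of the inner ones is positive, so the foot at its left
  end belongs to the inverse generator. Inner feet of inverse generators therefore have a direct
  partner; only those of the generators themselves force the reversed counter. If the oscillation of
  f below g is d > 0, then g has d bumps containing transition points of f, but f has only d - 1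
  containing transition points of g: stripping the outside of g leaves a pair of depth d - 1 with
  the roles exchanged.\<close>

type_synonym 'g letter = "'g \<times> bool"

definition linv :: "'g letter \<Rightarrow> 'g letter" where
  "linv a = (fst a, \<not> snd a)"

lemma linv_linv [simp]: "linv (linv a) = a"
  by (simp add: linv_def)

lemma fst_linv [simp]: "fst (linv a) = fst a"
  by (simp add: linv_def)

lemma linv_neq [simp]: "linv a \<noteq> a" "a \<noteq> linv a"
  by (auto simp: linv_def prod_eq_iff)

lemma linv_eq_iff: "linv a = b \<longleftrightarrow> a = linv b"
  by (auto simp: linv_def prod_eq_iff)

lemma same_gen_cases: "fst a = fst b \<Longrightarrow> a = b \<or> a = linv b"
  by (auto simp: linv_def prod_eq_iff)

fun word_act :: "('g letter \<Rightarrow> 'x \<Rightarrow> 'x) \<Rightarrow> 'g letter list \<Rightarrow> 'x \<Rightarrow> 'x" where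
  "word_act act [] x = x"
| "word_act act (a # w) x = word_act act w (act a x)"

lemma word_act_append: "word_act act (v @ w) x = word_act act w (word_act act v x)"
  by (induction v arbitrary: x) auto

text \<open>\<open>nxt l a\<close> is the foot into which \<open>a\<close> carries all of
  \<open>foot l\<close>, or \<open>None\<close> if \<open>a\<close> fixes that foot pointwise. The
  letter \<open>linv (ltr l)\<close> is excepted because it undoes the push that led into
  \<open>foot l\<close>. \<open>pull_back\<close> says that every move between feet seen
  geometrically is recorded by \<open>nxt\<close>; \<open>foot_deep\<close> and
  \<open>foot_shallow\<close> make stacks distinguishable by their action.\<close>

locale pingpong =
  fixes gens :: "'g set"
    and act :: "'g letter \<Rightarrow> real \<Rightarrow> real"
    and labels :: "'l set"
    and foot :: "'l \<Rightarrow> real set"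
    and ltr :: "'l \<Rightarrow> 'g letter"
    and nxt :: "'l \<Rightarrow> 'g letter \<Rightarrow> 'l option"
  assumes finite_gens: "finite gens"
    and act_linv [simp]: "\<And>a x. fst a \<in> gens \<Longrightarrow> act (linv a) (act a x) = x"
    and act_mono: "\<And>a x y. fst a \<in> gens \<Longrightarrow> x < y \<Longrightarrow> act a x < act a y"
    and ltr_gens: "\<And>l. l \<in> labels \<Longrightarrow> fst (ltr l) \<in> gens"
    and foot_disjoint: "\<And>l k x. l \<in> labels \<Longrightarrow> k \<in> labels \<Longrightarrow> x \<in> foot l \<Longrightarrow> x \<in> foot k \<Longrightarrow> l = k"
    and nxt_label: "\<And>l a k. l \<in> labels \<Longrightarrow> fst a \<in> gens \<Longrightarrow> a \<noteq> linv (ltr l) \<Longrightarrow> nxt l a = Some k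
          \<Longrightarrow> k \<in> labels \<and> ltr k = a"
    and nxt_Some: "\<And>l a k x. l \<in> labels \<Longrightarrow> fst a \<in> gens \<Longrightarrow> a \<noteq> linv (ltr l) \<Longrightarrow> nxt l a = Some k
          \<Longrightarrow> x \<in> foot l \<Longrightarrow> act a x \<in> foot k"
    and nxt_None: "\<And>l a x. l \<in> labels \<Longrightarrow> fst a \<in> gens \<Longrightarrow> a \<noteq> linv (ltr l) \<Longrightarrow> nxt l a = None
          \<Longrightarrow> x \<in> foot l \<Longrightarrow> act a x = x"
    and pull_back: "\<And>l k x. l \<in> labels \<Longrightarrow> k \<in> labels \<Longrightarrow> x \<in> foot k
          \<Longrightarrow> act (linv (ltr k)) x \<in> foot l \<Longrightarrow> ltr k \<noteq> linv (ltr l) \<and> nxt l (ltr k) = Some k"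
    and foot_deep: "\<And>l. l \<in> labels \<Longrightarrow> \<exists>x\<in>foot l. act (linv (ltr l)) x \<in> foot l"
    and foot_shallow: "\<And>l. l \<in> labels \<Longrightarrow> \<exists>x\<in>foot l. act (linv (ltr l)) x \<notin> foot l"
    and outside: "\<And>a y. fst a \<in> gens \<Longrightarrow> (\<forall>l\<in>labels. y \<notin> foot l)
          \<Longrightarrow> act a y = y \<or> (\<exists>k\<in>labels. ltr k = a \<and> act a y \<in> foot k)"
begin

lemma act_linv' [simp]: "fst a \<in> gens \<Longrightarrow> act a (act (linv a) x) = x"
  using act_linv[of "linv a" x] by simp

lemma act_eq_iff: "fst a \<in> gens \<Longrightarrow> act a x = act a y \<longleftrightarrow> x = y"
  by (metis act_linv)

definition wf_word :: "'g letter list \<Rightarrow> bool" where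
  "wf_word w \<longleftrightarrow> (\<forall>a\<in>set w. fst a \<in> gens)"

lemma wf_word_simps [simp]: "wf_word []" "wf_word (a # w) \<longleftrightarrow> fst a \<in> gens \<and> wf_word w"
  by (auto simp: wf_word_def)

lemma word_act_mono: "wf_word w \<Longrightarrow> x < y \<Longrightarrow> word_act act w x < word_act act w y"
  by (induction w arbitrary: x y) (auto simp: act_mono)

lemma word_act_eq_iff: "wf_word w \<Longrightarrow> word_act act w x = word_act act w y \<longleftrightarrow> x = y"
  by (induction w arbitrary: x y) (auto simp: act_eq_iff)

text \<open>\<^term>\<open>hist x y n\<close>: pulling x back n times through the feet containing it leads to
  the point y, which lies in no foot.\<close>
inductive hist :: "real \<Rightarrow> real \<Rightarrow> nat \<Rightarrow> bool" where
  hist_0: "(\<forall>l\<in>labels. y \<notin> foot l) \<Longrightarrow> hist y y 0"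
| hist_Suc: "l \<in> labels \<Longrightarrow> x \<in> foot l \<Longrightarrow> hist (act (linv (ltr l)) x) y n \<Longrightarrow> hist x y (Suc n)"

lemma hist_unique: "hist x y n \<Longrightarrow> hist x y' n' \<Longrightarrow> y = y' \<and> n = n'"
proof (induction arbitrary: y' n' rule: hist.induct)
  case (hist_0 y)
  then show ?case by (auto elim: hist.cases)
next
  case (hist_Suc l x y n)
  note l = hist_Suc.hyps(1,2) and IH = hist_Suc.IH
  from hist_Suc.prems show ?case
  proof cases
    case hist_0
    then show ?thesis using l by blast
  next
    case (hist_Suc l' n'')
    then have "l' = l" using foot_disjoint l by blast
    with hist_Suc IH[of y' n''] show ?thesis by blast
  qed
qed

text \<open>A letter prolongs a history by one foot, cancels its latest foot or fixes the point. The
  base point is never touched, so it is an invariant of the whole orbit.\<close>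

lemma hist_act:
  assumes "hist x y n" "fst a \<in> gens"
  shows "\<exists>n'. hist (act a x) y n'"
  using assms(1)
proof cases
  case hist_0
  from outside[OF assms(2) hist_0(3)] show ?thesis
  proof (elim disjE bexE conjE)
    assume "act a x = x" then show ?thesis using assms by auto
  next
    fix k assume k: "k \<in> labels" "ltr k = a" "act a x \<in> foot k"
    then have "hist (act a x) y (Suc 0)"
      using hist_0 assms by (intro hist_Suc[of k]) auto
    then show ?thesis by blast
  qed
next
  case (hist_Suc l n')
  show ?thesis
  proof (cases "a = linv (ltr l)")
    case True then show ?thesis using hist_Suc by auto
  next
    case False
    show ?thesis
    proof (cases "nxt l a")
      case None
      then show ?thesis using nxt_None[OF hist_Suc(2) assms(2) False] hist_Suc assms(1) by auto
    next
      case (Some k)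
      note k = nxt_label[OF hist_Suc(2) assms(2) False Some] nxt_Some[OF hist_Suc(2) assms(2) False Some hist_Suc(3)]
      have "hist (act a x) y (Suc n)"
        using k assms by (intro hist.hist_Suc[of k]) auto
      then show ?thesis by blast
    qed
  qed
qed

lemma hist_word_act: "hist x y n \<Longrightarrow> wf_word w \<Longrightarrow> \<exists>n'. hist (word_act act w x) y n'"
proof (induction w arbitrary: x n)
  case (Cons a w)
  then obtain n' where "hist (act a x) y n'" using hist_act[of x y n a] by auto
  then show ?case using Cons by auto
qed auto

lemma finite_letters: "finite (gens \<times> (UNIV :: bool set))"
  using finite_gens by simp

text \<open>A point with a history of length n is recovered from its base point by n letters, and
  there are finitely many letters.\<close>

lemma finite_hist: "finite {x. hist x y n}"
proof (induction n)
  case 0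
  have "{x. hist x y 0} \<subseteq> {y}" by (auto elim: hist.cases)
  then show ?case by (rule finite_subset) simp
next
  case (Suc n)
  have "{x. hist x y (Suc n)} \<subseteq> (\<Union>a\<in>gens \<times> UNIV. act a ` {x. hist x y n})"
  proof
    fix x assume "x \<in> {x. hist x y (Suc n)}"
    then have "hist x y (Suc n)" by simp
    then obtain l where l: "l \<in> labels" "hist (act (linv (ltr l)) x) y n"
      by (auto elim: hist.cases)
    have "ltr l \<in> gens \<times> UNIV" using ltr_gens[OF l(1)] by (auto simp: mem_Times_iff)
    moreover have "x \<in> act (ltr l) ` {x. hist x y n}"
      using l(2) ltr_gens[OF l(1)] by (intro image_eqI[of _ _ "act (linv (ltr l)) x"]) auto
    ultimately show "x \<in> (\<Union>a\<in>gens \<times> UNIV. act a ` {x. hist x y n})"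
      by (rule UN_I)
  qed
  moreover have "finite (\<Union>a\<in>gens \<times> UNIV. act a ` {x. hist x y n})"
    using Suc finite_letters by simp
  ultimately show ?case by (rule finite_subset)
qed

text \<open>Stacks list the feet visited by a point, the most recent one first.\<close>
fun valid :: "'l list \<Rightarrow> bool" where
  "valid [] \<longleftrightarrow> False"
| "valid [l] \<longleftrightarrow> l \<in> labels"
| "valid (k # l # S) \<longleftrightarrow> valid (l # S) \<and> k \<in> labels \<and> ltr k \<noteq> linv (ltr l) \<and> nxt l (ltr k) = Some k"

fun step :: "'g letter \<Rightarrow> 'l list \<Rightarrow> 'l list" where
  "step a [] = []"
| "step a (l # S) = (if a = linv (ltr l) then S else
     (case nxt l a of None \<Rightarrow> l # S | Some k \<Rightarrow> k # l # S))"

fun steps :: "'g letter list \<Rightarrow> 'l list \<Rightarrow> 'l list" where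
  "steps [] S = S"
| "steps (a # w) S = steps w (step a S)"

text \<open>The bottom label contributes no letter: the argument is already a point of the bottom
  foot.\<close>

fun ev :: "'l list \<Rightarrow> real \<Rightarrow> real" where
  "ev [] x = x"
| "ev [l] x = x"
| "ev (k # l # S) x = act (ltr k) (ev (l # S) x)"

lemma valid_labels: "valid S \<Longrightarrow> set S \<subseteq> labels"
  by (induction S rule: valid.induct) auto

lemma ev_foot: "valid S \<Longrightarrow> x \<in> foot (last S) \<Longrightarrow> ev S x \<in> foot (hd S)"
proof (induction S rule: valid.induct)
  case (3 k l S)
  then have l: "l \<in> labels" using valid_labels by force
  have "act (ltr k) (ev (l # S) x) \<in> foot k"
    using 3 by (intro nxt_Some[OF l ltr_gens]) auto
  then show ?case by simp
qed auto

text \<open>With at least two entries a pop leaves the bottom foot in place. A step lowers the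
  height by at most one, so a word shorter than the stack never consumes the bottom, and pushing and
  popping keeps computing the action.\<close>

lemma valid_step:
  assumes "valid S" "2 \<le> length S" "fst a \<in> gens"
  shows "valid (step a S)" "last (step a S) = last S" "length S \<le> Suc (length (step a S))"
    and "x \<in> foot (last S) \<Longrightarrow> ev (step a S) x = act a (ev S x)"
proof -
  obtain k l T where S: "S = k # l # T"
    using assms(2) by (cases S; cases "tl S") auto
  have k: "k \<in> labels" using assms(1) S by auto
  note nl = nxt_label[OF k assms(3)]
  show "valid (step a S)" using assms nl unfolding S by (auto split: option.splits)
  show "last (step a S) = last S" "length S \<le> Suc (length (step a S))"
    unfolding S by (auto split: option.splits)
  assume x: "x \<in> foot (last S)"
  show "ev (step a S) x = act a (ev S x)"
  proof (cases "a = linv (ltr k)")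
    case True then show ?thesis using ltr_gens[OF k] by (simp add: S)
  next
    case False
    then show ?thesis
      using nl[OF False] nxt_None[OF k assms(3) False] ev_foot[OF assms(1) x]
      by (auto simp: S split: option.splits)
  qed
qed

lemma valid_steps:
  assumes "valid S" "length w < length S" "wf_word w"
  shows "valid (steps w S) \<and> last (steps w S) = last S \<and>
    (\<forall>x\<in>foot (last S). ev (steps w S) x = word_act act w (ev S x))"
  using assms
proof (induction w arbitrary: S)
  case (Cons a w)
  have a: "fst a \<in> gens" "2 \<le> length S" using Cons.prems by auto
  note v = valid_step[OF Cons.prems(1) a(2) a(1)]
  have "length w < length (step a S)" using v(3) Cons.prems by simp
  then have "valid (steps w (step a S)) \<and> last (steps w (step a S)) = last S \<and>
    (\<forall>x\<in>foot (last S). ev (steps w (step a S)) x = word_act act w (ev (step a S) x))"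
    using Cons.IH[of "step a S"] v(1,2) Cons.prems by simp
  then show ?case using v(4) by simp
qed auto

lemma foot_nonempty: "l \<in> labels \<Longrightarrow> \<exists>x. x \<in> foot l"
  using foot_deep by blast

text \<open>If the stack had a second entry l below its top k, every point of \<open>foot k\<close>
  would pull back into \<open>foot l\<close>. A deep point of \<open>foot k\<close> then gives k = l
  by disjointness, and a shallow point contradicts this.\<close>

lemma ev_loop:
  assumes S: "valid S" "hd S = last S" and id: "\<And>x. x \<in> foot (last S) \<Longrightarrow> ev S x = x"
  shows "S = [last S]"
proof (cases S rule: valid.cases)
  case (3 k l T)
  have v: "valid (l # T)" and lb: "k \<in> labels" "l \<in> labels" and k: "last S = k"
    using S 3 valid_labels by force+
  have pb: "act (linv (ltr k)) x \<in> foot l" if "x \<in> foot k" for x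
  proof -
    have "x = act (ltr k) (ev (l # T) x)" using id[of x] that k 3 by auto
    moreover have "ev (l # T) x \<in> foot l" using ev_foot[OF v, of x] that k 3 by auto
    ultimately show ?thesis using ltr_gens[OF lb(1)] by (metis act_linv)
  qed
  from foot_deep[OF lb(1)] pb foot_disjoint[OF lb] have "k = l" by blast
  with foot_shallow[OF lb(1)] pb show ?thesis by blast
qed (use S in auto)

text \<open>The value of a stack lies in its top foot, so by disjointness equal values force equal
  tops. These are stripped by injectivity of the letters; if one stack is exhausted before the
  other, \<open>ev_loop\<close> applies.\<close>

lemma ev_inj:
  assumes "valid S" "valid S'" "last S = last S'"
    and "\<And>x. x \<in> foot (last S) \<Longrightarrow> ev S x = ev S' x"
  shows "S = S'"
  using assms
proof (induction S arbitrary: S')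
  case (Cons k S)
  have lb: "last (k # S) \<in> labels" "k \<in> labels" "hd S' \<in> labels"
    using valid_labels[OF Cons.prems(1)] valid_labels[OF Cons.prems(2)] Cons.prems(2)
    by (cases S'; auto simp: subset_iff)+
  obtain x where x: "x \<in> foot (last (k # S))" using foot_nonempty[OF lb(1)] by blast
  have hd: "k = hd S'"
    using ev_foot[OF Cons.prems(1) x] ev_foot[OF Cons.prems(2), of x] x Cons.prems(3) Cons.prems(4)[of x]
      foot_disjoint[OF lb(2,3)] by (auto simp del: ev.simps)
  show ?case
  proof (cases "S = [] \<or> tl S' = []")
    case True
    then show ?thesis
    proof
      assume "S = []"
      then have "S' = [last S']" using hd Cons.prems by (intro ev_loop) auto
      then show ?thesis using Cons.prems(3) \<open>S = []\<close> by simp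
    next
      assume "tl S' = []"
      then have S': "S' = [k]" using hd Cons.prems(2) by (cases S') auto
      have "k # S = [last (k # S)]"
        by (rule ev_loop) (use S' Cons.prems in auto)
      then show ?thesis using S' Cons.prems(3) by simp
    qed
  next
    case False
    then obtain l T l' T' where eq: "S = l # T" "S' = k # l' # T'"
      using hd Cons.prems(2) by (cases S; cases S'; cases "tl S'") auto
    have "S = l' # T'"
    proof (rule Cons.IH)
      fix y assume "y \<in> foot (last S)"
      then show "ev S y = ev (l' # T') y"
        using Cons.prems(4)[of y] eq act_eq_iff[OF ltr_gens[OF lb(2)]] by simp
    qed (use Cons.prems eq in auto)
    then show ?thesis using eq by simp
  qed
qed auto

text \<open>Pull the point back as long as it lies in a foot. Either n pull-backs end in yet another
  foot, which is then the bottom of a stack of height n + 1, or the process has stopped at a base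
  point.\<close>

lemma deep_or_hist:
  "(\<exists>S x0. valid S \<and> length S = Suc n \<and> x0 \<in> foot (last S) \<and> x = ev S x0) \<or> (\<exists>y k. k \<le> n \<and> hist x y k)"
proof (induction n arbitrary: x)
  case 0
  show ?case
  proof (cases "\<exists>l\<in>labels. x \<in> foot l")
    case True
    then obtain l where "l \<in> labels" "x \<in> foot l" by blast
    then have "valid [l] \<and> length [l] = Suc 0 \<and> x \<in> foot (last [l]) \<and> x = ev [l] x" by simp
    then show ?thesis by blast
  next
    case False
    then have "hist x x 0" by (intro hist_0) blast
    then show ?thesis by blast
  qed
next
  case (Suc n)
  show ?case
  proof (cases "\<exists>l\<in>labels. x \<in> foot l")
    case True
    then obtain k where k: "k \<in> labels" "x \<in> foot k" by blast
    note g = ltr_gens[OF k(1)]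
    from Suc[of "act (linv (ltr k)) x"] show ?thesis
    proof (elim disjE exE conjE)
      fix S x0 assume S: "valid S" "length S = Suc n" "x0 \<in> foot (last S)" "act (linv (ltr k)) x = ev S x0"
      then obtain l T where lT: "S = l # T" by (cases S) auto
      have "l \<in> labels" using S lT valid_labels by force
      with pull_back[OF this k] ev_foot[OF S(1,3)] S(4) lT
      have "valid (k # S)" using S k by simp
      moreover have "x = ev (k # S) x0" using S(4)[symmetric] g lT by simp
      moreover have "length (k # S) = Suc (Suc n)" "x0 \<in> foot (last (k # S))" using S lT by auto
      ultimately show ?thesis by blast
    next
      fix y m assume "m \<le> n" "hist (act (linv (ltr k)) x) y m"
      then have "Suc m \<le> Suc n \<and> hist x y (Suc m)" using k hist_Suc by auto
      then show ?thesis by blast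
    qed
  next
    case False
    then have "0 \<le> Suc n \<and> hist x x 0" by (intro conjI hist_0) auto
    then show ?thesis by blast
  qed
qed

text \<open>The points that are not fixed have short finite histories over a common base point; there
  are finitely many of those, but the orbit of a moved point under a monotone map is infinite.\<close>
lemma word_trivial_if_stacks:
  assumes w: "wf_word w" and n: "length w \<le> n"
    and fix_stack: "\<And>S. valid S \<Longrightarrow> length S = Suc n \<Longrightarrow> steps w S = S"
  shows "word_act act w x = x"
proof (rule ccontr)
  assume ne: "word_act act w x \<noteq> x"
  let ?f = "word_act act w"
  have short: "\<exists>y k. k \<le> n \<and> hist z y k" if "?f z \<noteq> z" for z
    using deep_or_hist[of n z]
  proof (elim disjE exE conjE)
    fix S x0 assume S: "valid S" "length S = Suc n" "x0 \<in> foot (last S)" "z = ev S x0"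
    then have "?f z = z"
      using valid_steps[OF S(1), of w] fix_stack[OF S(1,2)] n w by auto
    then show ?thesis using that by simp
  qed blast
  have moved: "?f ((?f ^^ i) x) \<noteq> (?f ^^ i) x" for i
  proof (induction i)
    case (Suc i) then show ?case using word_act_eq_iff[OF w] by auto
  qed (use ne in auto)
  obtain y where y: "\<exists>k. hist x y k" using short[OF ne] by blast
  have hy: "\<exists>k. hist ((?f ^^ i) x) y k" for i
    by (induction i) (use y hist_word_act[OF _ w] in auto)
  have in_fin: "(?f ^^ i) x \<in> (\<Union>k\<le>n. {x. hist x y k})" for i
    using short[OF moved[of i]] hy[of i] hist_unique by blast
  have "inj (\<lambda>i. (?f ^^ i) x)"
  proof (cases "x < ?f x")
    case True
    then have "(?f ^^ i) x < (?f ^^ Suc i) x" for i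
      by (induction i) (auto intro: word_act_mono[OF w])
    then show ?thesis by (intro strict_mono_imp_inj_on strict_monoI_Suc) auto
  next
    case False
    then have "?f x < x" using ne by simp
    then have "(?f ^^ Suc i) x < (?f ^^ i) x" for i
      by (induction i) (auto intro: word_act_mono[OF w])
    then have "strict_mono (\<lambda>i. - (?f ^^ i) x)" by (intro strict_monoI_Suc) auto
    then have "inj (\<lambda>i. - (?f ^^ i) x)" by (rule strict_mono_imp_inj_on)
    then show ?thesis by (simp add: inj_on_def)
  qed
  moreover have "finite (range (\<lambda>i. (?f ^^ i) x))"
    by (rule finite_subset[of _ "\<Union>k\<le>n. {x. hist x y k}"]) (use in_fin finite_hist in auto)
  ultimately show False using finite_imageD by force
qed

lemma stacks_if_word_trivial:
  assumes "wf_word w" "\<And>x. word_act act w x = x" "valid S" "length w < length S"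
  shows "steps w S = S"
proof -
  have "valid (steps w S) \<and> last (steps w S) = last S \<and>
    (\<forall>x\<in>foot (last S). ev (steps w S) x = word_act act w (ev S x))"
    using valid_steps[OF assms(3,4,1)] by simp
  then show ?thesis using assms by (intro ev_inj) auto
qed

text \<open>\<open>nxt\<close> is a function, so the bottom label and the sequence of letters pushed
  on it determine all labels. This lets a relation of labels that is not injective still prove
  equality of stacks.\<close>

lemma valid_eqI:
  "valid S \<Longrightarrow> valid T \<Longrightarrow> last S = last T \<Longrightarrow> map ltr S = map ltr T \<Longrightarrow> S = T"
proof (induction S arbitrary: T rule: valid.induct)
  case (2 l) then show ?case by (cases T) auto
next
  case (3 k l S)
  then obtain k' l' S' where T: "T = k' # l' # S'" by (cases T; cases "tl T") auto
  have "l # S = l' # S'" using 3 T by (intro "3.IH") auto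
  moreover have "nxt l (ltr k) = Some k" "nxt l' (ltr k') = Some k'" "ltr k = ltr k'"
    using "3.prems" T by auto
  ultimately have "k = k'" by (metis list.inject option.inject)
  with \<open>l # S = l' # S'\<close> T show ?case by simp
qed auto

end

section \<open>Comparison of two ping-pong systems\<close>

text \<open>\<open>R\<close> is a simulation that may be many to one but preserves letters. A
  special label has a partner with the inverse letter; toward all other generators the two must look
  alike, and under their own letters both must repeat themselves.\<close>

locale transfer =
  W1: pingpong gens act1 labels1 foot1 ltr1 nxt1 +
  W2: pingpong gens act2 labels2 foot2 ltr2 nxt2
  for gens :: "'g set"
    and act1 and labels1 :: "'l set" and foot1 ltr1 nxt1
    and act2 and labels2 :: "'m set" and foot2 ltr2 nxt2 +
  fixes R :: "'l \<Rightarrow> 'm \<Rightarrow> bool" and special :: "'l \<Rightarrow> bool"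
  assumes R_total: "\<And>l. l \<in> labels1 \<Longrightarrow> \<not> special l \<Longrightarrow> \<exists>l'\<in>labels2. R l l'"
    and R_ltr: "\<And>l l'. R l l' \<Longrightarrow> ltr2 l' = ltr1 l"
    and R_nxt: "\<And>l l' a. l \<in> labels1 \<Longrightarrow> l' \<in> labels2 \<Longrightarrow> R l l' \<Longrightarrow> fst a \<in> gens
          \<Longrightarrow> a \<noteq> linv (ltr1 l) \<Longrightarrow> rel_option R (nxt1 l a) (nxt2 l' a)"
    and special_partner: "\<And>l. l \<in> labels1 \<Longrightarrow> special l \<Longrightarrow> \<exists>l'\<in>labels2. ltr2 l' = linv (ltr1 l)
          \<and> nxt1 l (ltr1 l) = Some l \<and> nxt2 l' (ltr2 l') = Some l'
          \<and> (\<forall>a. fst a \<in> gens \<and> fst a \<noteq> fst (ltr1 l) \<longrightarrow> rel_option R (nxt1 l a) (nxt2 l' a))"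
begin

lemma R_letters: "list_all2 R S S' \<Longrightarrow> map ltr2 S' = map ltr1 S"
  by (induction rule: list_all2_induct) (auto simp: R_ltr)

lemma lift_plain: "W1.valid S \<Longrightarrow> \<not> special (last S) \<Longrightarrow> \<exists>S'. W2.valid S' \<and> list_all2 R S S'"
proof (induction S rule: W1.valid.induct)
  case (2 l)
  then obtain l' where "l' \<in> labels2" "R l l'" using R_total by auto
  then show ?case by (intro exI[of _ "[l']"]) simp
next
  case (3 k l S)
  then obtain S' where S': "W2.valid S'" "list_all2 R (l # S) S'" by auto
  then obtain l' T where T: "S' = l' # T" "R l l'" by (auto simp: list_all2_Cons1)
  have lb: "l \<in> labels1" "l' \<in> labels2"
    using W1.valid_labels 3 W2.valid_labels S' T by force+
  have k: "k \<in> labels1" "ltr1 k \<noteq> linv (ltr1 l)" "nxt1 l (ltr1 k) = Some k" using 3 by auto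
  with R_nxt[OF lb T(2) W1.ltr_gens[OF k(1)]] obtain k' where k': "nxt2 l' (ltr1 k) = Some k'" "R k k'"
    by (auto simp: option_rel_Some1)
  have "k' \<in> labels2"
    using W2.nxt_label[OF lb(2) W1.ltr_gens[OF k(1)] _ k'(1)] k(2) R_ltr[OF T(2)] by simp
  then have "W2.valid (k' # S')" using S' T k' k R_ltr[OF k'(2)] R_ltr[OF T(2)] by simp
  then show ?case using S' k' by blast
qed auto

lemma step_plain:
  assumes "W1.valid S" "W2.valid S'" "list_all2 R S S'" "fst a \<in> gens"
  shows "list_all2 R (W1.step a S) (W2.step a S')"
proof -
  obtain k S1 k' S2 where S: "S = k # S1" "S' = k' # S2" "R k k'" "list_all2 R S1 S2"
    using assms by (cases S) (auto simp: list_all2_Cons1)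
  have "k \<in> labels1" "k' \<in> labels2" using assms S W1.valid_labels W2.valid_labels by force+
  from R_nxt[OF this S(3) assms(4)] R_ltr[OF S(3)] show ?thesis
    using S by (auto split: option.splits)
qed

lemma steps_plain:
  assumes "W1.valid S" "W2.valid S'" "list_all2 R S S'" "W1.wf_word w" "length w < length S"
  shows "list_all2 R (W1.steps w S) (W2.steps w S')"
  using assms
proof (induction w arbitrary: S S')
  case (Cons a w)
  have a: "2 \<le> length S" "2 \<le> length S'" "fst a \<in> gens"
    using Cons.prems list_all2_lengthD[OF Cons.prems(3)] by auto
  show ?case
    using Cons.IH[OF W1.valid_step(1)[OF Cons.prems(1) a(1,3)] W2.valid_step(1)[OF Cons.prems(2) a(2,3)]
        step_plain[OF Cons.prems(1-3) a(3)]] W1.valid_step(3)[OF Cons.prems(1) a(1,3)] Cons.prems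
    by simp
qed auto

text \<open>A special foot and its partner belong to inverse letters of one generator: pushing on one side
  is matched by popping on the other, so the sum of the two counters is constant.\<close>
definition paired :: "'l \<Rightarrow> 'm \<Rightarrow> nat \<Rightarrow> nat \<Rightarrow> 'l list \<Rightarrow> 'm list \<Rightarrow> bool" where
  "paired l l' M q S S' \<longleftrightarrow> (\<exists>h h' p. S = h @ replicate p l \<and> S' = h' @ replicate q l' \<and> list_all2 R h h'
     \<and> 1 \<le> p \<and> 1 \<le> q \<and> p + q = M \<and> W1.valid S \<and> W2.valid S'
     \<and> (h \<noteq> [] \<longrightarrow> fst (ltr1 (last h)) \<noteq> fst (ltr1 l)))"

context
  fixes l l'
  assumes l: "l \<in> labels1" and l': "l' \<in> labels2" and ltr': "ltr2 l' = linv (ltr1 l)"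
    and self: "nxt1 l (ltr1 l) = Some l" "nxt2 l' (ltr2 l') = Some l'"
    and other: "\<And>a. fst a \<in> gens \<Longrightarrow> fst a \<noteq> fst (ltr1 l) \<Longrightarrow> rel_option R (nxt1 l a) (nxt2 l' a)"
begin

lemma valid_replicate: "1 \<le> q \<Longrightarrow> W2.valid (replicate q l')"
proof (induction q)
  case (Suc q)
  then show ?case using l' self by (cases q) auto
qed simp

text \<open>The height q of the partner's counter is free: it is chosen in advance as large as a
  word requires. Only the sum with the actual counter p stays fixed afterwards.\<close>

lemma lift_special:
  assumes "W1.valid S" "last S = l" "1 \<le> q"
  shows "\<exists>p S'. paired l l' (p + q) q S S'"
  using assms
proof (induction S rule: W1.valid.induct)
  case (2 k)
  then have "paired l l' (1 + q) q [k] (replicate q l')"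
    unfolding paired_def using valid_replicate
    by (intro exI[of _ "[]"] exI[of _ "1::nat"]) auto
  then show ?case by blast
next
  case (3 k m S)
  then obtain p S' where P: "paired l l' (p + q) q (m # S) S'" by auto
  then obtain h h' where h: "m # S = h @ replicate p l" "S' = h' @ replicate q l'" "list_all2 R h h'"
    "1 \<le> p" "W2.valid S'" "h \<noteq> [] \<Longrightarrow> fst (ltr1 (last h)) \<noteq> fst (ltr1 l)"
    unfolding paired_def by auto
  have k: "k \<in> labels1" "ltr1 k \<noteq> linv (ltr1 m)" "nxt1 m (ltr1 k) = Some k" using 3 by auto
  note kg = W1.ltr_gens[OF k(1)]
  show ?case
  proof (cases h)
    case Nil
    then have m: "m = l" using h(1,4) by (cases p) auto
    show ?thesis
    proof (cases "fst (ltr1 k) = fst (ltr1 l)")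
      case True
      then have "ltr1 k = ltr1 l" using same_gen_cases k(2) m by blast
      then have "k = l" by (metis k(3) self(1) m option.inject)
      then have "paired l l' (Suc p + q) q (k # m # S) S'"
        unfolding paired_def using h Nil 3(2) 3(4)
        by (intro exI[of _ "[]"] exI[of _ "Suc p"]) auto
      then show ?thesis by blast
    next
      case False
      from other[OF kg False] k m obtain k' where k': "nxt2 l' (ltr1 k) = Some k'" "R k k'"
        by (auto simp: option_rel_Some1)
      have ne: "ltr1 k \<noteq> linv (ltr2 l')" using False ltr' by auto
      then have k'l: "k' \<in> labels2" "ltr2 k' = ltr1 k"
        using W2.nxt_label[OF l' kg _ k'(1)] by auto
      have S': "S' = l' # replicate (q - 1) l'"
        using h Nil 3(4) by (cases q) auto
      have "W2.valid (k' # S')" using S' h(5) k'l k' ne by simp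
      then have "paired l l' (p + q) q (k # m # S) (k' # S')"
        unfolding paired_def using h Nil 3(2) 3(4) False k'
        by (intro exI[of _ "[k]"] exI[of _ "[k']"] exI[of _ p]) auto
      then show ?thesis by blast
    qed
  next
    case (Cons m0 h0)
    then have m0: "m0 = m" using h by simp
    with Cons h obtain m' h0' where m': "h' = m' # h0'" "R m m'" by (auto simp: list_all2_Cons1)
    have lb: "m \<in> labels1" "m' \<in> labels2"
      using W1.valid_labels[OF 3(2)] W2.valid_labels[OF h(5)] h(2) m'(1) by auto
    from R_nxt[OF lb m'(2) kg k(2)] k obtain k' where k': "nxt2 m' (ltr1 k) = Some k'" "R k k'"
      by (auto simp: option_rel_Some1)
    have ne: "ltr1 k \<noteq> linv (ltr2 m')" using k(2) R_ltr[OF m'(2)] by simp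
    then have k'l: "k' \<in> labels2" "ltr2 k' = ltr1 k"
      using W2.nxt_label[OF lb(2) kg _ k'(1)] by auto
    have "W2.valid (k' # S')" using h m' k'l k' ne by simp
    then have "paired l l' (p + q) q (k # m # S) (k' # S')"
      unfolding paired_def using h Cons 3(2) 3(4) k'
      by (intro exI[of _ "k # h"] exI[of _ "k' # h'"] exI[of _ p]) auto
    then show ?thesis by blast
  qed
qed auto

lemma step_special:
  assumes P: "paired l l' M q S S'" and len: "2 \<le> length S" "2 \<le> q" and a: "fst a \<in> gens"
  shows "\<exists>q'. q \<le> Suc q' \<and> paired l l' M q' (W1.step a S) (W2.step a S')"
proof -
  from P obtain h h' p where h: "S = h @ replicate p l" "S' = h' @ replicate q l'" "list_all2 R h h'"
    "1 \<le> p" "p + q = M" "W1.valid S" "W2.valid S'" "h \<noteq> [] \<Longrightarrow> fst (ltr1 (last h)) \<noteq> fst (ltr1 l)"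
    unfolding paired_def by auto
  have len': "2 \<le> length S'" using h len by simp
  note v = W1.valid_step(1)[OF h(6) len(1) a] W2.valid_step(1)[OF h(7) len' a]
  show ?thesis
  proof (cases h)
    case Nil
    then obtain p0 where p0: "p = Suc (Suc p0)" using h len by (cases p; cases "p - 1") auto
    obtain q0 where q0: "q = Suc (Suc q0)" using len by (cases q; cases "q - 1") auto
    have S: "S = l # l # replicate p0 l" "S' = l' # l' # replicate q0 l'"
      using h Nil p0 q0 by auto
    consider "a = ltr1 l" | "a = linv (ltr1 l)" | "fst a \<noteq> fst (ltr1 l)" using same_gen_cases by blast
    then show ?thesis
    proof cases
      case 1
      have "paired l l' M (q - 1) (W1.step a S) (W2.step a S')"
        unfolding paired_def using v 1 S self ltr' h(5) p0 q0
        by (intro exI[of _ "[]"] exI[of _ "Suc p"]) auto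
      then show ?thesis by (intro exI[of _ "q - 1"]) auto
    next
      case 2
      have "paired l l' M (Suc q) (W1.step a S) (W2.step a S')"
        unfolding paired_def using v 2 S self ltr' h(5) p0 q0
        by (intro exI[of _ "[]"] exI[of _ "p - 1"]) (auto simp: linv_eq_iff)
      then show ?thesis by (intro exI[of _ "Suc q"]) auto
    next
      case 3
      then have ne: "a \<noteq> linv (ltr1 l)" "a \<noteq> linv (ltr2 l')" using ltr' by auto
      from other[OF a 3] show ?thesis
      proof (cases rule: option.rel_cases)
        case None
        then show ?thesis using P ne S by (intro exI[of _ q]) auto
      next
        case (Some k k')
        then have "ltr1 k = a" using W1.nxt_label[OF l a ne(1)] by auto
        then have "paired l l' M q (W1.step a S) (W2.step a S')"
          unfolding paired_def using v S h(4,5) p0 q0 Some ne 3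
          by (intro exI[of _ "[k]"] exI[of _ "[k']"] exI[of _ p]) auto
        then show ?thesis by (intro exI[of _ q]) auto
      qed
    qed
  next
    case (Cons k h0)
    then obtain k' h0' where h': "h' = k' # h0'" "R k k'" "list_all2 R h0 h0'"
      using h by (auto simp: list_all2_Cons1)
    have lb: "k \<in> labels1" "k' \<in> labels2"
      using W1.valid_labels[OF h(6)] W2.valid_labels[OF h(7)] h h' Cons by auto
    show ?thesis
    proof (cases "a = linv (ltr1 k)")
      case True
      have "paired l l' M q (W1.step a S) (W2.step a S')"
        unfolding paired_def using v h h' Cons True R_ltr[OF h'(2)] len
        by (intro exI[of _ h0] exI[of _ h0'] exI[of _ p]) (auto split: if_splits)
      then show ?thesis by (intro exI[of _ q]) auto
    next
      case False
      then have ne: "a \<noteq> linv (ltr2 k')" using R_ltr[OF h'(2)] by simp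
      from R_nxt[OF lb h'(2) a False] show ?thesis
      proof (cases rule: option.rel_cases)
        case None
        then show ?thesis using P ne False h h' Cons by (intro exI[of _ q]) auto
      next
        case (Some m m')
        then have "paired l l' M q (W1.step a S) (W2.step a S')"
          unfolding paired_def using v h h' Cons False ne len
          by (intro exI[of _ "m # h"] exI[of _ "m' # h'"] exI[of _ p]) (auto split: if_splits)
        then show ?thesis by (intro exI[of _ q]) auto
      qed
    qed
  qed
qed

lemma steps_special:
  assumes "paired l l' M q S S'" "W1.wf_word w" "length w < length S" "length w < q"
  shows "\<exists>q'. paired l l' M q' (W1.steps w S) (W2.steps w S')"
  using assms
proof (induction w arbitrary: q S S')
  case (Cons a w)
  have a: "2 \<le> length S" "2 \<le> q" "fst a \<in> gens" using Cons.prems by auto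
  from step_special[OF Cons.prems(1) a] obtain q' where
    q': "q \<le> Suc q'" "paired l l' M q' (W1.step a S) (W2.step a S')" by blast
  have "W1.valid S" using Cons.prems(1) by (auto simp: paired_def)
  from W1.valid_step(3)[OF this a(1,3)] Cons.IH[OF q'(2)] q'(1) Cons.prems show ?case by simp
qed auto

text \<open>In the partner stack the bottom run of \<open>l'\<close> ends visibly, since the next
  label belongs to another generator. So the stack determines q, the sum M then determines p, and
  the letters above the run are copied by \<open>R\<close>. \<open>valid_eqI\<close> recovers the
  labels.\<close>

lemma paired_eq:
  assumes "paired l l' M q S U" "paired l l' M q1 T U"
  shows "S = T"
proof -
  from assms(1) obtain h h' p where h: "S = h @ replicate p l" "U = h' @ replicate q l'" "list_all2 R h h'"
    "1 \<le> p" "p + q = M" "W1.valid S" "h \<noteq> [] \<Longrightarrow> fst (ltr1 (last h)) \<noteq> fst (ltr1 l)"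
    unfolding paired_def by auto
  from assms(2) obtain g g' p1 where g: "T = g @ replicate p1 l" "U = g' @ replicate q1 l'" "list_all2 R g g'"
    "1 \<le> p1" "p1 + q1 = M" "W1.valid T" "g \<noteq> [] \<Longrightarrow> fst (ltr1 (last g)) \<noteq> fst (ltr1 l)"
    unfolding paired_def by auto
  have strip: "length (takeWhile ((=) l') (rev (f' @ replicate n l'))) = n"
    if "list_all2 R f f'" "f \<noteq> [] \<Longrightarrow> fst (ltr1 (last f)) \<noteq> fst (ltr1 l)" for f f' n
  proof (cases f' rule: rev_cases)
    case Nil then show ?thesis by (simp add: takeWhile_replicate)
  next
    case (snoc f0' k')
    then have "list_all2 R f (f0' @ [k'])" using that(1) by simp
    then obtain f0 k where "f = f0 @ [k]" "R k k'"
      unfolding list_all2_append2 list_all2_Cons2 by auto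
    then have "l' \<noteq> k'" using that(2) R_ltr ltr' by fastforce
    then show ?thesis using snoc by (simp add: takeWhile_append takeWhile_replicate)
  qed
  have q: "q = q1"
    using strip[OF h(3,7), of q, folded h(2)] strip[OF g(3,7), of q1, folded g(2)] by simp
  then have "h' = g'" using h(2) g(2) by simp
  then have "map ltr1 S = map ltr1 T" using R_letters[OF h(3)] R_letters[OF g(3)] h g q by simp
  then show ?thesis using W1.valid_eqI[OF h(6) g(6)] h g by simp
qed

end

theorem trivial_transfer:
  assumes w: "W1.wf_word w" and triv: "\<And>x. word_act act2 w x = x"
  shows "word_act act1 w x = x"
proof (rule W1.word_trivial_if_stacks[OF w order_refl])
  fix S assume S: "W1.valid S" "length S = Suc (length w)"
  have w2: "W2.wf_word w" using w unfolding W1.wf_word_def W2.wf_word_def .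
  show "W1.steps w S = S"
  proof (cases "special (last S)")
    case False
    then obtain S' where S': "W2.valid S'" "list_all2 R S S'" using lift_plain S by blast
    have fix': "W2.steps w S' = S'"
      using list_all2_lengthD[OF S'(2)] S by (intro W2.stacks_if_word_trivial[OF w2 triv S'(1)]) simp
    have "list_all2 R (W1.steps w S) S'"
      using steps_plain[OF S(1) S' w] S fix' by simp
    then have "map ltr1 (W1.steps w S) = map ltr1 S"
      using R_letters S'(2) by metis
    then show ?thesis using W1.valid_steps[OF S(1) _ w] S by (intro W1.valid_eqI) auto
  next
    case True
    have last: "last S \<in> labels1" using W1.valid_labels[OF S(1)] S by (cases S rule: rev_cases) auto
    from special_partner[OF this True] obtain l' where l': "l' \<in> labels2" "ltr2 l' = linv (ltr1 (last S))"
      "nxt1 (last S) (ltr1 (last S)) = Some (last S)" "nxt2 l' (ltr2 l') = Some l'"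
      "\<And>a. fst a \<in> gens \<Longrightarrow> fst a \<noteq> fst (ltr1 (last S)) \<Longrightarrow> rel_option R (nxt1 (last S) a) (nxt2 l' a)"
      by blast
    \<comment> \<open>A counter higher than the length of the word cannot be exhausted while the
      word is read.\<close>
    from lift_special[OF last l' S(1) refl, of "Suc (length w)"] obtain p S' where
      P: "paired (last S) l' (p + Suc (length w)) (Suc (length w)) S S'" by auto
    then have v: "W2.valid S'" "length w < length S'" by (auto simp: paired_def)
    from steps_special[OF last l' P w] S obtain q' where
      "paired (last S) l' (p + Suc (length w)) q' (W1.steps w S) (W2.steps w S')" by auto
    then have "paired (last S) l' (p + Suc (length w)) q' (W1.steps w S) S'"
      using W2.stacks_if_word_trivial[OF w2 triv v] by simp
    from paired_eq[OF last l' P this] show ?thesis by simp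
  qed
qed

end

section \<open>Interlaced sequences of transition points\<close>

text \<open>There are d comparisons from each side: \<open>y 0 < x 0 < y 1 < x 1 < ...\<close> from
  the left and \<open>y n > x m > y (n - 1) > x (m - 1) > ...\<close> from the right. The last two
  clauses are the end of the recursion: the remainders are separated, with the one that is currently
  the smaller function on the left. Which of x and y that is depends on the parity of d.\<close>

definition interlaced :: "nat \<Rightarrow> (nat \<Rightarrow> real) \<Rightarrow> nat \<Rightarrow> (nat \<Rightarrow> real) \<Rightarrow> nat \<Rightarrow> bool" where
  "interlaced d x m y n \<longleftrightarrow>
     (\<forall>i. 2 * i + 1 \<le> d \<longrightarrow> y i < x i \<and> x (m - i) < y (n - i))
   \<and> (\<forall>i. 2 * i + 2 \<le> d \<longrightarrow> x i < y (i + 1) \<and> y (n - (i + 1)) < x (m - i))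
   \<and> (\<forall>j. d = 2 * j \<longrightarrow> x (m - j) \<le> y j)
   \<and> (\<forall>j. d = 2 * j + 1 \<longrightarrow> y (n - (j + 1)) \<le> x j)"

lemma interlaced_0 [simp]: "interlaced 0 x m y n \<longleftrightarrow> x m \<le> y 0"
  by (auto simp: interlaced_def)

lemma interlacedD:
  assumes "interlaced d x m y n"
  shows "2 * i + 1 \<le> d \<Longrightarrow> y i < x i" "2 * i + 1 \<le> d \<Longrightarrow> x (m - i) < y (n - i)"
    "2 * i + 2 \<le> d \<Longrightarrow> x i < y (i + 1)" "2 * i + 2 \<le> d \<Longrightarrow> y (n - (i + 1)) < x (m - i)"
    "d = 2 * i \<Longrightarrow> x (m - i) \<le> y i" "d = 2 * i + 1 \<Longrightarrow> y (n - (i + 1)) \<le> x i"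
  using assms unfolding interlaced_def by blast+

text \<open>One unfolding of the recursion for standard pairs: z is what is left of y without its
  two end points, and it is now the first of the pair. Agreement with y is asked only at the
  outermost \<open>d div 2 + 1\<close> points of each side, the ones that depth d inspects, so z may
  differ from a true inner sequence elsewhere.\<close>

lemma interlaced_Suc:
  assumes eq: "\<And>i. i \<le> d div 2 \<Longrightarrow> z i = y (i + 1) \<and> z (p - i) = y (n - (i + 1))"
  shows "interlaced (Suc d) x m y n \<longleftrightarrow> y 0 < x 0 \<and> x m < y n \<and> interlaced d z p x m"
    (is "?L \<longleftrightarrow> ?R")
proof
  assume L: ?L
  note D = interlacedD[OF L]
  have "y 0 < x 0" "x m < y n" using D(1,2)[of 0] by auto
  moreover have "interlaced d z p x m"
    unfolding interlaced_def
  proof (intro conjI allI impI)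
    fix i
    assume d: "2 * i + 1 \<le> d"
    then have "i \<le> d div 2" by linarith
    with eq D(3,4)[of i] d show "x i < z i" "z (p - i) < x (m - i)" by auto
  next
    fix i
    assume d: "2 * i + 2 \<le> d"
    then have "i \<le> d div 2" by linarith
    with eq D(1,2)[of "i + 1"] d show "z i < x (i + 1)" "x (m - (i + 1)) < z (p - i)" by auto
  next
    fix i
    assume d: "d = 2 * i"
    with eq[of i] D(6)[of i] show "z (p - i) \<le> x i" by auto
  next
    fix i
    assume d: "d = 2 * i + 1"
    with eq[of i] D(5)[of "i + 1"] show "x (m - (i + 1)) \<le> z i" by auto
  qed
  ultimately show ?R by blast
next
  assume R: ?R
  then have b: "y 0 < x 0" "x m < y n" by auto
  note D = interlacedD[OF R[THEN conjunct2, THEN conjunct2]]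
  show ?L
    unfolding interlaced_def
  proof (intro conjI allI impI)
    fix i
    assume d: "2 * i + 1 \<le> Suc d"
    show "y i < x i"
    proof (cases i)
      case (Suc i0)
      then have "i0 \<le> d div 2" "2 * i0 + 2 \<le> d" using d by linarith+
      with Suc eq D(3)[of i0] show ?thesis by auto
    qed (use b in simp)
    show "x (m - i) < y (n - i)"
    proof (cases i)
      case (Suc i0)
      then have "i0 \<le> d div 2" "2 * i0 + 2 \<le> d" using d by linarith+
      with Suc eq D(4)[of i0] show ?thesis by auto
    qed (use b in simp)
  next
    fix i
    assume d: "2 * i + 2 \<le> Suc d"
    then have "i \<le> d div 2" by linarith
    with eq D(1,2)[of i] d show "x i < y (i + 1)" "y (n - (i + 1)) < x (m - i)" by auto
  next
    fix i
    assume d: "Suc d = 2 * i"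
    then obtain i0 where i0: "i = Suc i0" by (cases i) auto
    then have "i0 \<le> d div 2" "d = 2 * i0 + 1" using d by linarith+
    with i0 eq D(6)[of i0] show "x (m - i) \<le> y i" by auto
  next
    fix i
    assume d: "Suc d = 2 * i + 1"
    then have "i \<le> d div 2" by linarith
    with eq D(5)[of i] d show "y (n - (i + 1)) \<le> x i" by auto
  qed
qed

text \<open>The index of the gap of y containing the k-th point of x, when x and y are interlaced to
  depth d. Removing the two end points of y turns the same situation into one of depth d - 1 with
  the roles of x and y exchanged; this locates the points of y in \<open>loc_outer\<close>.\<close>
definition loc :: "nat \<Rightarrow> nat \<Rightarrow> nat \<Rightarrow> nat \<Rightarrow> nat option" where
  "loc d m n k = (if d = 0 then None else if k < d div 2 then Some k
     else if m - k < d div 2 then Some (n - (m - k) - 1)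
     else if even d then Some (d div 2 - 1) else Some (n - d div 2 - 1))"

definition loc_outer :: "nat \<Rightarrow> nat \<Rightarrow> nat \<Rightarrow> nat \<Rightarrow> nat option" where
  "loc_outer d m n k = (if k = 0 \<or> k = n then None else loc (d - 1) (n - 2) m (k - 1))"

text \<open>The half-open intervals anticipate feet: a foot whose left end is p extends to the right
  of p, so \<open>p = y n\<close> already counts as outside. \<open>left_of\<close> is the mirror
  image for a right end.\<close>

definition right_of :: "(nat \<Rightarrow> real) \<Rightarrow> nat \<Rightarrow> real \<Rightarrow> nat option \<Rightarrow> bool" where
  "right_of y n p g \<longleftrightarrow> (case g of None \<Rightarrow> p < y 0 \<or> y n \<le> p
     | Some q \<Rightarrow> q < n \<and> y q \<le> p \<and> p < y (Suc q))"

definition left_of :: "(nat \<Rightarrow> real) \<Rightarrow> nat \<Rightarrow> real \<Rightarrow> nat option \<Rightarrow> bool" where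
  "left_of y n p g \<longleftrightarrow> (case g of None \<Rightarrow> p \<le> y 0 \<or> y n < p
     | Some q \<Rightarrow> q < n \<and> y q < p \<and> p \<le> y (Suc q))"

text \<open>The outer points are located by the interlacing inequalities directly. All middle points
  are squeezed by monotonicity into the innermost gap reached by the interlacing, which is counted
  from the left for even d and from the right for odd d. The excluded coincidences are those of two
  left ends or of two right ends, which disjoint feet rule out.\<close>

lemma interlaced_loc:
  assumes I: "interlaced d x m y n" and x: "strict_mono_on {..m} x"
    and b: "d \<le> n" "d \<le> m + 1" "0 < n" and k: "k \<le> m"
  shows "(\<forall>q<n. x k \<noteq> y q) \<Longrightarrow> right_of y n (x k) (loc d m n k)"
    and "(\<forall>q\<in>{1..n}. x k \<noteq> y q) \<Longrightarrow> left_of y n (x k) (loc d m n k)"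
proof -
  define j where "j = d div 2"
  have xm: "x a \<le> x b" if "a \<le> b" "b \<le> m" for a b
    using strict_mono_onD[OF x, of a b] that by (cases "a = b") auto
  note I1 = interlacedD(1,2)[OF I] and I2 = interlacedD(3,4)[OF I]
    and I3 = interlacedD(5)[OF I] and I4 = interlacedD(6)[OF I]
  have strict: thesis
    if "loc d m n k = Some q" "q < n" "y q < x k" "x k < y (Suc q)"
      "right_of y n (x k) (loc d m n k) \<Longrightarrow> left_of y n (x k) (loc d m n k) \<Longrightarrow> thesis" for q thesis
    using that by (auto simp: right_of_def left_of_def)
  have "((\<forall>q<n. x k \<noteq> y q) \<longrightarrow> right_of y n (x k) (loc d m n k))
      \<and> ((\<forall>q\<in>{1..n}. x k \<noteq> y q) \<longrightarrow> left_of y n (x k) (loc d m n k))"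
  proof (cases "d = 0")
    case True
    then have "loc d m n k = None" "x k \<le> y 0"
      using I xm[OF k order_refl] by (auto simp: loc_def)
    moreover have "x k < y 0" if "\<forall>q<n. x k \<noteq> y q"
      using \<open>x k \<le> y 0\<close> that b(3) less_le by blast
    ultimately show ?thesis by (auto simp: right_of_def left_of_def)
  next
    case d: False
    show ?thesis
    proof (cases "k < j")
      case True
      have "loc d m n k = Some k" using d True by (simp add: loc_def j_def)
      moreover have "y k < x k" "x k < y (Suc k)" "k < n"
        using I1[of k] I2[of k] True b unfolding j_def by auto
      ultimately show ?thesis using strict by blast
    next
      case kj: False
      show ?thesis
      proof (cases "m - k < j")
        case True
        have q: "Suc (n - (m - k) - 1) = n - (m - k)" "n - (m - k) - 1 = n - ((m - k) + 1)" "n - (m - k) - 1 < n"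
          using True b unfolding j_def by auto
        have "loc d m n k = Some (n - (m - k) - 1)" using d True kj by (simp add: loc_def j_def)
        moreover have "y (n - ((m - k) + 1)) < x k" "x k < y (n - (m - k))"
          using I1[of "m - k"] I2[of "m - k"] True k unfolding j_def by auto
        ultimately show ?thesis using strict q by metis
      next
        case mk: False
        show ?thesis
        proof (cases "even d")
          case True
          then have dj: "d = 2 * j" unfolding j_def by simp
          have j: "0 < j" using d dj by simp
          have l: "loc d m n k = Some (j - 1)" using d True kj mk by (simp add: loc_def j_def)
          have "y (j - 1) < x (j - 1)" using I1[of "j - 1"] dj j by simp
          also have "\<dots> \<le> x k" using kj k by (intro xm) auto
          finally have 1: "y (j - 1) < x k" .
          have "x k \<le> x (m - j)" using mk k by (intro xm) auto
          also have "\<dots> \<le> y j" using I3 dj by simp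
          finally have 2: "x k \<le> y j" .
          have jn: "j < n" "j - 1 < n" using dj b j by auto
          have "x k < y j" if "\<forall>q<n. x k \<noteq> y q"
            using 2 that jn less_le by blast
          then show ?thesis using l 1 2 j jn by (auto simp: right_of_def left_of_def)
        next
          case False
          then have dj: "d = 2 * j + 1" unfolding j_def by presburger
          have jn: "j < n" using dj b by simp
          have l: "loc d m n k = Some (n - j - 1)" using d False kj mk by (simp add: loc_def j_def)
          have q: "Suc (n - j - 1) = n - j" "n - (j + 1) = n - j - 1" using jn by auto
          have "y (n - (j + 1)) \<le> x j" using I4 dj by simp
          also have "\<dots> \<le> x k" using kj k by (intro xm) auto
          finally have 1: "y (n - j - 1) \<le> x k" using q by simp
          have "x k \<le> x (m - j)" using mk k by (intro xm) auto
          also have "\<dots> < y (n - j)" using I1[of j] dj by simp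
          finally have 2: "x k < y (n - j)" .
          have "y 0 < x 0" using I1[of 0] dj by simp
          also have "\<dots> \<le> x k" using k by (intro xm) auto
          finally have 3: "y 0 < x k" .
          \<comment> \<open>The point \<open>y 0\<close> is never a right end, so the assumption
            says nothing about it; there the strict inequality comes from the outermost
            layer.\<close>
          have "y (n - j - 1) < x k" if "\<forall>q\<in>{1..n}. x k \<noteq> y q"
          proof (cases "n - j - 1 = 0")
            case True then show ?thesis using 3 by simp
          next
            case False
            then have "x k \<noteq> y (n - j - 1)" using that by (auto simp: Suc_le_eq)
            then show ?thesis using 1 by simp
          qed
          then show ?thesis using l 1 2 q jn by (auto simp: right_of_def left_of_def less_imp_le)
        qed
      qed
    qed
  qed
  then show "(\<forall>q<n. x k \<noteq> y q) \<Longrightarrow> right_of y n (x k) (loc d m n k)"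
    and "(\<forall>q\<in>{1..n}. x k \<noteq> y q) \<Longrightarrow> left_of y n (x k) (loc d m n k)" by blast+
qed

lemma interlaced_loc_outer:
  assumes I: "interlaced d x m y n" and y: "strict_mono_on {..n} y"
    and b: "d \<le> n" "d \<le> m + 1" "0 < m" "0 < n"
  shows "k < n \<Longrightarrow> (\<forall>q<m. y k \<noteq> x q) \<Longrightarrow> right_of x m (y k) (loc_outer d m n k)"
    and "1 \<le> k \<Longrightarrow> k \<le> n \<Longrightarrow> (\<forall>q\<in>{1..m}. y k \<noteq> x q) \<Longrightarrow> left_of x m (y k) (loc_outer d m n k)"
proof -
  have ym: "y a \<le> y b" if "a \<le> b" "b \<le> n" for a b
    using strict_mono_onD[OF y, of a b] that by (cases "a = b") auto
  have "(k < n \<longrightarrow> (\<forall>q<m. y k \<noteq> x q) \<longrightarrow> right_of x m (y k) (loc_outer d m n k))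
    \<and> (1 \<le> k \<longrightarrow> k \<le> n \<longrightarrow> (\<forall>q\<in>{1..m}. y k \<noteq> x q) \<longrightarrow> left_of x m (y k) (loc_outer d m n k))"
  proof (cases "d = 0")
    case True
    then have "loc_outer d m n k = None" by (simp add: loc_outer_def loc_def)
    moreover have "x m \<le> y k" if "k \<le> n" using I True ym[of 0 k] that by simp
    moreover have "x m < y k" if "1 \<le> k" "k \<le> n"
      using I True strict_mono_onD[OF y, of 0 k] that by simp
    ultimately show ?thesis by (auto simp: right_of_def left_of_def)
  next
    case d: False
    have e: "y 0 < x 0" "x m < y n"
      using interlacedD(1,2)[OF I, of 0] d by auto
    show ?thesis
    proof (cases "k = 0 \<or> k = n")
      case True
      then have "loc_outer d m n k = None" by (auto simp: loc_outer_def)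
      then show ?thesis using True e by (auto simp: right_of_def left_of_def)
    next
      case k: False
      show ?thesis
      \<comment> \<open>Depth 1 is separate because n may then be 1, in which case removing both end
        points of y leaves no sequence to locate.\<close>
      proof (cases "d = 1")
        case True
        then have "loc_outer d m n k = None" by (simp add: loc_outer_def loc_def)
        moreover have le: "y k \<le> x 0" if "k \<le> n"
        proof -
          have "y k \<le> y (n - 1)" using that k by (intro ym) auto
          also have "\<dots> \<le> x 0" using interlacedD(6)[OF I, of 0] True by simp
          finally show ?thesis .
        qed
        moreover have "y k < x 0" if "k \<le> n" "\<forall>q<m. y k \<noteq> x q"
          using le that b(3) less_le by blast
        ultimately show ?thesis by (auto simp: right_of_def left_of_def)
      next
        case False
        define z where "z = (\<lambda>i. y (i + 1))"
        have d2: "2 \<le> d" "2 \<le> n" using d False b by auto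
        have eq: "z i = y (i + 1) \<and> z (n - 2 - i) = y (n - (i + 1))" if "i \<le> (d - 1) div 2" for i
        proof -
          have "i \<le> n - 2" using that b d2 by linarith
          then show ?thesis unfolding z_def using d2 by (auto intro!: arg_cong[of _ _ y])
        qed
        have "interlaced (d - 1) z (n - 2) x m"
          using interlaced_Suc[of "d - 1" z y "n - 2" n x m, OF eq] I d by simp
        moreover have "strict_mono_on {..n - 2} z"
          unfolding z_def using d2 by (intro strict_mono_onI strict_mono_onD[OF y]) auto
        ultimately have "(\<forall>q<m. z (k - 1) \<noteq> x q) \<Longrightarrow> right_of x m (z (k - 1)) (loc (d - 1) (n - 2) m (k - 1))"
          "(\<forall>q\<in>{1..m}. z (k - 1) \<noteq> x q) \<Longrightarrow> left_of x m (z (k - 1)) (loc (d - 1) (n - 2) m (k - 1))"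
          if "k \<le> n"
          using interlaced_loc[of "d - 1" z "n - 2" x m "k - 1"] d2 b that k by auto
        moreover have "z (k - 1) = y k" using k by (simp add: z_def)
        ultimately show ?thesis using k by (auto simp: loc_outer_def)
      qed
    qed
  qed
  then show "k < n \<Longrightarrow> (\<forall>q<m. y k \<noteq> x q) \<Longrightarrow> right_of x m (y k) (loc_outer d m n k)"
    and "1 \<le> k \<Longrightarrow> k \<le> n \<Longrightarrow> (\<forall>q\<in>{1..m}. y k \<noteq> x q) \<Longrightarrow> left_of x m (y k) (loc_outer d m n k)"
    by blast+
qed

text \<open>The c div 2 leftmost and the (c + 1) div 2 rightmost bumps are the ones that contain
  transition points of other functions; the number of bumps between them is arbitrary. If c = 0, no
  bump contains any, and all bumps may be identified.\<close>
definition bump_match :: "nat \<Rightarrow> nat \<Rightarrow> nat \<Rightarrow> nat \<Rightarrow> nat \<Rightarrow> bool" where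
  "bump_match c m m' k k' \<longleftrightarrow> k < m \<and> k' < m' \<and>
     (c = 0 \<or> k = k' \<and> k < c div 2 \<or> m - k = m' - k' \<and> m - k \<le> (c + 1) div 2)"

text \<open>The end points of the inner bumps, including the two at which the outer bumps begin. All
  of them fall into the same gap of any other function, so \<open>pt_match\<close> need not tell
  them apart.\<close>

definition core_pt :: "nat \<Rightarrow> nat \<Rightarrow> nat \<Rightarrow> bool" where
  "core_pt c m k \<longleftrightarrow> c div 2 \<le> k \<and> k \<le> m - (c + 1) div 2"

definition pt_match :: "nat \<Rightarrow> nat \<Rightarrow> nat \<Rightarrow> nat \<Rightarrow> nat \<Rightarrow> bool" where
  "pt_match c m m' k k' \<longleftrightarrow> k \<le> m \<and> k' \<le> m' \<and>
     (c = 0 \<or> k = k' \<and> k \<le> c div 2 \<or> m - k = m' - k' \<and> m - k \<le> (c + 1) div 2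
      \<or> core_pt c m k \<and> core_pt c m' k')"

text \<open>The gap shared by all middle points. Counting it from the left or from the right
  according to parity makes its index independent of how many inner bumps the other function
  has.\<close>

definition loc_core :: "nat \<Rightarrow> nat \<Rightarrow> nat option" where
  "loc_core d n = (if even d then Some (d div 2 - 1) else Some (n - d div 2 - 1))"

lemma loc_eq:
  "0 < d \<Longrightarrow> k < d div 2 \<Longrightarrow> loc d m n k = Some k"
  "0 < d \<Longrightarrow> d div 2 \<le> k \<Longrightarrow> m - k < d div 2 \<Longrightarrow> loc d m n k = Some (n - (m - k) - 1)"
  "0 < d \<Longrightarrow> (if even d then d div 2 - 1 else d div 2) \<le> k \<Longrightarrow> d div 2 \<le> m - k
     \<Longrightarrow> loc d m n k = loc_core d n"
  by (auto simp: loc_def loc_core_def)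

lemma loc_core_match:
  assumes "0 < d" "d \<le> e" "e \<le> n" "e \<le> n'"
  shows "rel_option (bump_match e n n') (loc_core d n) (loc_core d n')"
proof (cases "even d")
  case True
  then obtain j where j: "d = 2 * j" by (elim evenE)
  then have "j \<le> e div 2" using assms by linarith
  then show ?thesis using j assms True by (auto simp: loc_core_def bump_match_def)
next
  case False
  then obtain j where j: "d = 2 * j + 1" by (elim oddE)
  then have "j + 1 \<le> (e + 1) div 2" using assms by linarith
  then show ?thesis using j assms False by (auto simp: loc_core_def bump_match_def)
qed

text \<open>Points nearer to an end than \<open>d div 2\<close> are outer points, and
  \<open>pt_match\<close> keeps their distance from that end. All others lie in the common gap,
  where even unequal indices give matching answers.\<close>

lemma loc_match:
  assumes k: "pt_match c m m' k k'" and d: "d \<le> c + 1" "d \<le> e"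
    and b: "c \<le> m" "c \<le> m'" "e \<le> n" "e \<le> n'"
  shows "rel_option (bump_match e n n') (loc d m n k) (loc d m' n' k')"
proof (cases "d = 0")
  case True
  then show ?thesis by (simp add: loc_def)
next
  case False
  then have d0: "0 < d" by simp
  define j where "j = d div 2"
  \<comment> \<open>For even d the left point with index \<open>d div 2 - 1\<close> already lies in
    the common gap. This extra step is needed: if \<open>d = c + 1\<close> is even,
    \<open>d div 2\<close> exceeds \<open>c div 2\<close> by one, so the leftmost core point has
    just this index.\<close>
  define j0 where "j0 = (if even d then d div 2 - 1 else d div 2)"
  define l where "l = c div 2"
  define r where "r = (c + 1) div 2"
  have j: "j0 \<le> l" "j \<le> r" "2 * j \<le> c + 1" "j0 \<le> j" "j \<le> e div 2" "j \<le> (e + 1) div 2" "j \<le> e"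
    unfolding j_def j0_def l_def r_def using d by (auto elim!: evenE oddE)
  have lr: "l + r = c" unfolding l_def r_def by linarith
  have core: ?thesis if "j0 \<le> k" "j \<le> m - k" "j0 \<le> k'" "j \<le> m' - k'"
    using loc_core_match[OF d0 d(2) b(3,4)] loc_eq(3)[OF d0] that unfolding j0_def j_def by simp
  have kb: "k \<le> m" "k' \<le> m'" using k by (auto simp: pt_match_def)
  from k consider "c = 0" | "k = k'" "k \<le> l" | "m - k = m' - k'" "m - k \<le> r"
    | "l \<le> k" "k \<le> m - r" "l \<le> k'" "k' \<le> m' - r"
    unfolding pt_match_def core_pt_def l_def r_def by blast
  then show ?thesis
  proof cases
    case 1
    then show ?thesis using core lr j by simp
  next
    case 2
    show ?thesis
    proof (cases "k < j")
      case True
      then have "bump_match e n n' k k'" using 2 j b by (auto simp: bump_match_def)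
      then show ?thesis using loc_eq(1)[OF d0] True 2 unfolding j_def by simp
    next
      case False
      with 2 j lr b show ?thesis by (intro core) auto
    qed
  next
    case 3
    show ?thesis
    proof (cases "m - k < j")
      case True
      have "j \<le> k" "j \<le> k'" using True 3 j b kb by auto
      moreover have "bump_match e n n' (n - (m - k) - 1) (n' - (m' - k') - 1)"
        using True 3 j b by (auto simp: bump_match_def)
      ultimately show ?thesis using loc_eq(2)[OF d0] True 3 unfolding j_def by simp
    next
      case False
      with 3 j lr b kb show ?thesis by (intro core) auto
    qed
  next
    case 4
    with j lr b kb show ?thesis by (intro core) auto
  qed
qed

text \<open>The end points of the larger function lie outside the smaller one. Removing them
  exchanges the roles and lowers d by one and e by two, and the bound
  \<open>d - 1 \<le> (e - 2) + 1\<close> demanded by \<open>loc_match\<close> is exactly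
  \<open>d \<le> e\<close>.\<close>

lemma loc_outer_match:
  assumes k: "pt_match e n n' k k'" and d: "d \<le> c + 1" "d \<le> e"
    and b: "c \<le> m" "c \<le> m'" "e \<le> n" "e \<le> n'"
  shows "rel_option (bump_match c m m') (loc_outer d m n k) (loc_outer d m' n' k')"
proof (cases "d \<le> 1")
  case True
  then have "d - 1 = 0" by simp
  then show ?thesis by (simp add: loc_outer_def loc_def)
next
  case False
  define l where "l = e div 2"
  define r where "r = (e + 1) div 2"
  have lr: "l + r = e" "l \<le> r" "1 \<le> l" "r \<le> l + 1" "(e - 2) div 2 = l - 1" "(e - 2 + 1) div 2 = r - 1"
    unfolding l_def r_def using False d by linarith+
  have k4: "k \<le> n" "k' \<le> n'" "k = k' \<and> k \<le> l \<or> n - k = n' - k' \<and> n - k \<le> r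
      \<or> l \<le> k \<and> k \<le> n - r \<and> l \<le> k' \<and> k' \<le> n' - r"
    using k False d unfolding pt_match_def core_pt_def l_def r_def by auto
  have ends: "k = 0 \<or> k = n \<longleftrightarrow> k' = 0 \<or> k' = n'"
    using k4 b lr by auto
  show ?thesis
  proof (cases "k = 0 \<or> k = n")
    case True
    then show ?thesis using ends by (simp add: loc_outer_def)
  next
    case int: False
    have "pt_match (e - 2) (n - 2) (n' - 2) (k - 1) (k' - 1)"
    proof -
      have i: "0 < k" "k < n" "0 < k'" "k' < n'" using int ends k4(1,2) by auto
      have e: "n - 2 - (k - 1) = n - k - 1" "n' - 2 - (k' - 1) = n' - k' - 1"
        "n - 2 - (r - 1) = n - r - 1" "n' - 2 - (r - 1) = n' - r - 1"
        using i lr(2,3) by simp_all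
      have bd: "k - 1 \<le> n - 2" "k' - 1 \<le> n' - 2" using i by simp_all
      have "k - 1 = k' - 1 \<and> k - 1 \<le> l - 1
        \<or> n - k - 1 = n' - k' - 1 \<and> n - k - 1 \<le> r - 1
        \<or> l - 1 \<le> k - 1 \<and> k - 1 \<le> n - r - 1 \<and> l - 1 \<le> k' - 1 \<and> k' - 1 \<le> n' - r - 1"
        using k4(3) diff_le_mono[of k l 1] diff_le_mono[of "n - k" r 1] diff_le_mono[of l k 1]
          diff_le_mono[of k "n - r" 1] diff_le_mono[of l k' 1] diff_le_mono[of k' "n' - r" 1]
        by metis
      then show ?thesis
        using bd unfolding pt_match_def core_pt_def lr(5,6) e by blast
    qed
    then have "rel_option (bump_match c m m') (loc (d - 1) (n - 2) m (k - 1)) (loc (d - 1) (n' - 2) m' (k' - 1))"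
      using d b False by (intro loc_match[of "e - 2"]) auto
    then show ?thesis using int ends by (simp add: loc_outer_def)
  qed
qed

lemma bump_match_pts:
  assumes "bump_match c m m' k k'"
  shows "pt_match c m m' k k'" "pt_match c m m' (Suc k) (Suc k')"
  using assms unfolding bump_match_def pt_match_def by auto

section \<open>Homeomorphisms and standard functions\<close>

text \<open>Since \<open>homeo\<close> prescribes the identity outside the unit interval, its
  members are increasing bijections of the whole line. Inverses and the ping-pong action can thus be
  taken on all reals.\<close>

abbreviation finv :: "(real \<Rightarrow> real) \<Rightarrow> real \<Rightarrow> real" where
  "finv f \<equiv> inv_into UNIV f"

lemma homeo_strict_mono:
  assumes "homeo f"
  shows "strict_mono f"
proof (rule strict_monoI)
  fix s t :: real assume st: "s < t"
  from assms obtain g where g: "homeomorphism {0..1} {0..1} f g" and m: "mono_on {0..1} f"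
    and o: "\<And>t. t \<notin> {0..1} \<Longrightarrow> f t = t" unfolding homeo_def by blast
  have in01: "f t \<in> {0..1}" if "t \<in> {0..1}" for t
    using g that unfolding homeomorphism_def by blast
  show "f s < f t"
  proof (cases "s \<in> {0..1} \<and> t \<in> {0..1}")
    case True
    then have "f s \<le> f t" using m st by (auto intro: mono_onD)
    moreover have "f s \<noteq> f t" using g True st unfolding homeomorphism_def by (metis less_irrefl)
    ultimately show ?thesis by simp
  next
    case False
    then show ?thesis using in01[of s] in01[of t] o[of s] o[of t] st
      by (cases "s \<in> {0..1}"; cases "t \<in> {0..1}") auto
  qed
qed

lemma homeo_image: "homeo f \<Longrightarrow> f ` {0..1} = {0..1}"
  unfolding homeo_def homeomorphism_def by blast

lemma homeo_outside: "homeo f \<Longrightarrow> t \<notin> {0..1} \<Longrightarrow> f t = t"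
  unfolding homeo_def by blast

lemma homeo_continuous: "homeo f \<Longrightarrow> continuous_on {0..1} f"
  unfolding homeo_def homeomorphism_def by blast

lemma homeo_bij:
  assumes "homeo f" shows "bij f"
proof (rule bijI)
  show "inj f" using homeo_strict_mono[OF assms] by (rule strict_mono_imp_inj_on)
  have "t \<in> range f" for t
  proof (cases "t \<in> {0..1}")
    case True
    then have "t \<in> f ` {0..1}" using homeo_image[OF assms] by simp
    then show ?thesis by blast
  next
    case False
    then show ?thesis using homeo_outside[OF assms False] by (metis rangeI)
  qed
  then show "surj f" by blast
qed

lemma homeo_01:
  assumes "homeo f" shows "f 0 = 0" "f 1 = 1"
proof -
  note m = homeo_strict_mono[OF assms] and im = homeo_image[OF assms]
  have "f 0 \<in> {0..1}" "f 1 \<in> {0..1}" using im by auto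
  moreover obtain a b where "a \<in> {0..1}" "f a = 0" "b \<in> {0..1}" "f b = 1"
    using im by (metis (no_types, lifting) atLeastAtMost_iff imageE order_refl zero_le_one)
  ultimately show "f 0 = 0" "f 1 = 1"
    using strict_mono_less_eq[OF m, of 0 a] strict_mono_less_eq[OF m, of b 1] by auto
qed

lemma homeo_inv:
  assumes "homeo f" shows "homeo (finv f)"
proof -
  from assms obtain g where g: "homeomorphism {0..1} {0..1} f g" unfolding homeo_def by blast
  note b = homeo_bij[OF assms]
  have eq: "finv f t = g t" if "t \<in> {0..1}" for t
    using g that b unfolding homeomorphism_def by (metis bij_inv_eq_iff)
  have "homeomorphism {0..1} {0..1} g f" using g by (rule homeomorphism_symD)
  then have "homeomorphism {0..1} {0..1} (finv f) f"
    by (rule homeomorphism_cong) (auto simp: eq)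
  moreover have "mono_on {0..1} (finv f)"
    using strict_mono_inv[OF homeo_strict_mono[OF assms]] b
    by (intro mono_onI) (metis bij_is_surj strict_mono_less_eq homeo_strict_mono[OF assms] surj_f_inv_f)
  moreover have "finv f t = t" if "t \<notin> {0..1}" for t
    using homeo_outside[OF assms that] b by (metis bij_inv_eq_iff)
  ultimately show ?thesis unfolding homeo_def by blast
qed

lemma inv_strict_mono: "homeo f \<Longrightarrow> strict_mono (finv f)"
  by (intro homeo_strict_mono homeo_inv)

lemma fix_off_supt: "homeo f \<Longrightarrow> t \<notin> supt f \<Longrightarrow> f t = t"
  using homeo_outside by (auto simp: supt_def)

lemma inv_fix: "homeo f \<Longrightarrow> f t = t \<Longrightarrow> finv f t = t"
  using homeo_bij by (metis bij_inv_eq_iff)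

lemma orbital_subset: "(u, v) \<in> orbitals f \<Longrightarrow> {u<..<v} \<subseteq> supt f"
  unfolding orbitals_def by (auto dest: in_components_subset)

lemma orbital_ends_notin:
  assumes "(u, v) \<in> orbitals f"
  shows "u \<notin> supt f" "v \<notin> supt f"
proof -
  have uv: "u < v" and C: "{u<..<v} \<in> components (supt f)" using assms by (auto simp: orbitals_def)
  have max: "D = {u<..<v}" if "{u<..<v} \<subseteq> D" "D \<subseteq> supt f" "connected D" for D
    using C that uv unfolding in_components_maximal by (metis subset_empty)
  have sub: "{u<..<v} \<subseteq> supt f" using orbital_subset[OF assms] .
  show "u \<notin> supt f"
  proof
    assume "u \<in> supt f"
    then have "{u..<v} = {u<..<v}" using sub uv by (intro max) (force simp: less_le connected_Ico)+
    then show False using uv by (metis atLeastLessThan_iff greaterThanLessThan_iff less_irrefl order_refl)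
  qed
  show "v \<notin> supt f"
  proof
    assume "v \<in> supt f"
    then have "{u<..v} = {u<..<v}" using sub uv by (intro max) (force simp: less_le connected_Ioc)+
    then show False using uv by (metis greaterThanAtMost_iff greaterThanLessThan_iff less_irrefl order_refl)
  qed
qed

lemma open_supt:
  assumes "homeo f" shows "open (supt f)"
proof -
  have "supt f = {t \<in> {0<..<1}. f t - t \<noteq> 0}"
    using homeo_01[OF assms] unfolding supt_def by (auto simp: less_le)
  also have "\<dots> = {0<..<1} \<inter> (\<lambda>t. f t - t) -` (- {0})" by auto
  also have "open \<dots>"
    using homeo_continuous[OF assms]
    by (intro continuous_open_preimage continuous_intros) (auto elim: continuous_on_subset)
  finally show ?thesis .
qed

lemma supt_orbitals:
  assumes "homeo f" "z \<in> supt f"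
  shows "\<exists>u v. (u, v) \<in> orbitals f \<and> u < z \<and> z < v"
proof -
  define C where "C = connected_component_set (supt f) z"
  have C: "C \<in> components (supt f)" "z \<in> C" unfolding C_def using assms by (auto simp: components_def)
  have op: "open C" using open_components[OF open_supt[OF assms(1)] C(1)] .
  have con: "connected C" using C in_components_connected by blast
  have bd: "C \<subseteq> {0..1}" using in_components_subset[OF C(1)] by (auto simp: supt_def)
  then have bdd: "bdd_above C" "bdd_below C" by (meson bdd_above_Icc bdd_above_mono bdd_below_Icc bdd_below_mono)+
  have "C = {Inf C<..<Sup C}"
  proof (intro Set.set_eqI iffI)
    fix t assume t: "t \<in> C"
    with op obtain e where e: "e > 0" "ball t e \<subseteq> C" by (auto simp: open_contains_ball)
    have "t - e/2 \<in> C" "t + e/2 \<in> C" using e by (auto intro!: subsetD[OF e(2)] simp: dist_real_def)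
    then have "Inf C \<le> t - e/2" "t + e/2 \<le> Sup C" using bdd by (auto intro: cInf_lower cSup_upper)
    then show "t \<in> {Inf C<..<Sup C}" using e by auto
  next
    fix t assume t: "t \<in> {Inf C<..<Sup C}"
    then obtain a b where "a \<in> C" "a < t" "b \<in> C" "t < b"
      using C(2) cInf_lessD[of C t] less_cSupD[of C t] by auto
    then show "t \<in> C" using connected_contains_Icc[OF con, of a b] by auto
  qed
  note eq = this
  have "Inf C < z" "z < Sup C" using C(2) eq by (metis greaterThanLessThan_iff)+
  moreover from this have "(Inf C, Sup C) \<in> orbitals f"
    using C(1) unfolding orbitals_def by (simp flip: eq)
  ultimately show ?thesis by blast
qed

lemma orbital_sign:
  assumes "homeo f" "J \<in> orbitals f"
  shows "positive_on f J \<or> (\<forall>t. fst J < t \<and> t < snd J \<longrightarrow> f t < t)"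
proof (rule ccontr)
  obtain u v where J: "J = (u, v)" by (cases J)
  assume "\<not> ?thesis"
  then obtain s t where st: "u < s" "s < v" "f s \<le> s" "u < t" "t < v" "t \<le> f t"
    unfolding J positive_on_def by (auto simp: not_less)
  have sub: "{u<..<v} \<subseteq> supt f" using orbital_subset assms J by blast
  have "connected ((\<lambda>t. f t - t) ` {u<..<v})"
    using sub by (intro connected_continuous_image continuous_intros
      continuous_on_subset[OF homeo_continuous[OF assms(1)]]) (auto simp: supt_def)
  from connectedD_interval[OF this, of "f s - s" "f t - t" 0] st
  have "0 \<in> (\<lambda>t. f t - t) ` {u<..<v}" by auto
  then show False using sub by (auto simp: supt_def)
qed

section \<open>Standard functions as chains of adjacent bumps\<close>

definition bumps :: "(real \<Rightarrow> real) \<Rightarrow> (nat \<Rightarrow> real) \<Rightarrow> nat \<Rightarrow> bool" where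
  "bumps f x m \<longleftrightarrow> 0 < m \<and> strict_mono_on {..m} x \<and> supt f = (\<Union>k<m. {x k<..<x (Suc k)})"

lemma bumps_less: "bumps f x m \<Longrightarrow> i < j \<Longrightarrow> j \<le> m \<Longrightarrow> x i < x j"
  unfolding bumps_def by (auto intro: strict_mono_onD)

lemma bumps_le: "bumps f x m \<Longrightarrow> i \<le> j \<Longrightarrow> j \<le> m \<Longrightarrow> x i \<le> x j"
  using bumps_less[of f x m i j] by (cases "i = j") auto

lemma bumps_pt_notin: "bumps f x m \<Longrightarrow> k \<le> m \<Longrightarrow> x k \<notin> supt f"
proof
  assume b: "bumps f x m" "k \<le> m" "x k \<in> supt f"
  then obtain i where i: "i < m" "x i < x k" "x k < x (Suc i)" by (auto simp: bumps_def)
  show False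
  proof (cases "k \<le> i")
    case True then show False using bumps_le[OF b(1) True] i by simp
  next
    case False then show False using bumps_le[OF b(1), of "Suc i" k] i b by simp
  qed
qed

lemma bumps_gap_unique:
  assumes "bumps f x m" "i < m" "j < m" "x i < t" "t < x (Suc i)" "x j < t" "t < x (Suc j)"
  shows "i = j"
proof (rule ccontr)
  assume "i \<noteq> j"
  then consider "Suc i \<le> j" | "Suc j \<le> i" by linarith
  then show False
    using bumps_le[OF assms(1), of "Suc i" j] bumps_le[OF assms(1), of "Suc j" i] assms by cases auto
qed

lemma bumps_supt_iff: "bumps f x m \<Longrightarrow> t \<in> supt f \<longleftrightarrow> (\<exists>k<m. x k < t \<and> t < x (Suc k))"
  by (auto simp: bumps_def)

lemma bumps_gap_subset: "bumps f x m \<Longrightarrow> k < m \<Longrightarrow> {x k<..<x (Suc k)} \<subseteq> supt f"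
  using bumps_supt_iff[of f x m] by auto

lemma bumps_orbitals:
  assumes "bumps f x m"
  shows "orbitals f = (\<lambda>k. (x k, x (Suc k))) ` {..<m}"
proof -
  have comp: "{x k<..<x (Suc k)} \<in> components (supt f)" if k: "k < m" for k
    unfolding in_components_maximal
  proof (intro conjI allI impI)
    have lt: "x k < x (Suc k)" using bumps_less[OF assms] k by simp
    then show "{x k<..<x (Suc k)} \<noteq> {}" by simp
    show "{x k<..<x (Suc k)} \<subseteq> supt f" using bumps_gap_subset[OF assms k] .
    show "connected {x k<..<x (Suc k)}" by (rule connected_Ioo)
    fix D assume D: "D \<noteq> {} \<and> {x k<..<x (Suc k)} \<subseteq> D \<and> D \<subseteq> supt f \<and> connected D"
    obtain c where c: "x k < c" "c < x (Suc k)" using lt dense by blast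
    then have cD: "c \<in> D" using D by auto
    have "z \<in> {x k<..<x (Suc k)}" if z: "z \<in> D" for z
    proof (rule ccontr)
      assume "z \<notin> {x k<..<x (Suc k)}"
      then consider "z \<le> x k" | "x (Suc k) \<le> z" by fastforce
      then show False
      proof cases
        case 1
        have "{z..c} \<subseteq> D" using connected_contains_Icc[of D z c] D cD z by blast
        then have "x k \<in> D" using 1 c by auto
        then show False using D bumps_pt_notin[OF assms, of k] k by auto
      next
        case 2
        have "{c..z} \<subseteq> D" using connected_contains_Icc[of D c z] D cD z by blast
        then have "x (Suc k) \<in> D" using 2 c by auto
        then show False using D bumps_pt_notin[OF assms, of "Suc k"] k by auto
      qed
    qed
    then show "D = {x k<..<x (Suc k)}" using D by blast
  qed
  show ?thesis
  proof (intro Set.set_eqI iffI)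
    fix J assume "J \<in> orbitals f"
    then obtain u v where J: "J = (u, v)" "u < v" "{u<..<v} \<in> components (supt f)"
      by (auto simp: orbitals_def)
    obtain c where c: "u < c" "c < v" using dense[OF J(2)] by blast
    then have "c \<in> supt f" using J in_components_subset by fastforce
    then obtain k where k: "k < m" "x k < c" "c < x (Suc k)" using bumps_supt_iff[OF assms] by blast
    then have "{u<..<v} = {x k<..<x (Suc k)}"
      using components_eq[OF J(3) comp[OF k(1)]] c by auto
    then have "u = x k \<and> v = x (Suc k)" using J(2) bumps_less[OF assms, of k "Suc k"] k
      by (simp add: greaterThanLessThan_eq_iff)
    then show "J \<in> (\<lambda>k. (x k, x (Suc k))) ` {..<m}" using k J by auto
  next
    fix J assume "J \<in> (\<lambda>k. (x k, x (Suc k))) ` {..<m}"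
    then show "J \<in> orbitals f"
      using comp bumps_less[OF assms] by (auto simp: orbitals_def)
  qed
qed

lemma bumps_inj: "bumps f x m \<Longrightarrow> inj_on (\<lambda>k. (x k, x (Suc k))) {..<m}"
proof (rule inj_onI)
  fix i j assume b: "bumps f x m" and ij: "i \<in> {..<m}" "j \<in> {..<m}" "(x i, x (Suc i)) = (x j, x (Suc j))"
  then show "i = j"
    using bumps_less[OF b, of i j] bumps_less[OF b, of j i] by (cases i j rule: linorder_cases) auto
qed

lemma bumps_card: "bumps f x m \<Longrightarrow> card (orbitals f) = m"
  by (simp add: bumps_orbitals card_image[OF bumps_inj])

lemma bumps_ext_supt:
  assumes "bumps f x m" shows "ext_supt f = {x 0<..<x m}"
proof -
  have "closure (supt f) = {x 0..x m}"
  proof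
    have "supt f \<subseteq> {x 0..x m}"
    proof
      fix t assume "t \<in> supt f"
      then obtain k where "k < m" "x k < t" "t < x (Suc k)" using bumps_supt_iff[OF assms] by blast
      then show "t \<in> {x 0..x m}" using bumps_le[OF assms, of 0 k] bumps_le[OF assms, of "Suc k" m] by auto
    qed
    then show "closure (supt f) \<subseteq> {x 0..x m}" by (rule closure_minimal) simp
    have "{x 0..x k} \<subseteq> closure (supt f)" if "k \<le> m" "0 < k" for k
      using that
    proof (induction k)
      case (Suc k)
      have "{x k<..<x (Suc k)} \<subseteq> supt f" using Suc.prems bumps_gap_subset[OF assms] by simp
      then have "closure {x k<..<x (Suc k)} \<subseteq> closure (supt f)" by (rule closure_mono)
      moreover have "x k < x (Suc k)" using bumps_less[OF assms] Suc by simp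
      ultimately have "{x k..x (Suc k)} \<subseteq> closure (supt f)" by simp
      note step = this
      show ?case
      proof (cases "k = 0")
        case True then show ?thesis using step by simp
      next
        case False
        have "{x 0..x (Suc k)} \<subseteq> {x 0..x k} \<union> {x k..x (Suc k)}" by auto
        moreover have "{x 0..x k} \<subseteq> closure (supt f)" using Suc.IH Suc.prems False by simp
        ultimately show ?thesis using step by blast
      qed
    qed simp
    then show "{x 0..x m} \<subseteq> closure (supt f)" using assms by (auto simp: bumps_def)
  qed
  then show ?thesis by (simp add: ext_supt_def)
qed

lemma bumps_trans_pts:
  assumes "bumps f x m" shows "trans_pts f = x ` {..m}"
proof -
  have "trans_pts f = (\<Union>k<m. {x k, x (Suc k)})"
    unfolding trans_pts_def bumps_orbitals[OF assms] by auto
  also have "\<dots> = x ` {..m}"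
  proof (intro Set.set_eqI iffI)
    fix p assume "p \<in> x ` {..m}"
    then obtain k where k: "k \<le> m" "p = x k" by auto
    show "p \<in> (\<Union>k<m. {x k, x (Suc k)})"
    proof (cases "k = m")
      case True
      then have "m - 1 < m \<and> p = x (Suc (m - 1))" using k assms by (auto simp: bumps_def)
      then show ?thesis by blast
    next
      case False
      then have "k < m \<and> p = x k" using k by auto
      then show ?thesis by blast
    qed
  next
    fix p assume "p \<in> (\<Union>k<m. {x k, x (Suc k)})"
    then obtain k where "k < m" "p = x k \<or> p = x (Suc k)" by blast
    then have "p = x k \<and> k \<in> {..m} \<or> p = x (Suc k) \<and> Suc k \<in> {..m}" by auto
    then show "p \<in> x ` {..m}" by blast
  qed
  finally show ?thesis .
qed

text \<open>Because the extended support is an interval, the support is dense between any two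
  consecutive transition points and meets that gap. An orbital meeting the gap contains no
  transition point and has transition points as ends, so it is the gap.\<close>

lemma standard_bumps:
  assumes "standard F"
  shows "\<exists>x m. bumps (fst F) x m"
proof -
  let ?f = "fst F"
  obtain a b where ab: "a < b" "ext_supt ?f = {a<..<b}" using assms by (auto simp: standard_def)
  have h: "homeo ?f" and fin: "finite (orbitals ?f)" using assms by (auto simp: standard_def marked_def)
  define P where "P = trans_pts ?f"
  have "P = fst ` orbitals ?f \<union> snd ` orbitals ?f" unfolding P_def trans_pts_def by force
  then have P: "finite P" using fin by simp
  define L where "L = sorted_list_of_set P"
  define x where "x = (\<lambda>k. L ! k)"
  have L: "set L = P" "sorted_wrt (<) L" "length L = card P"
    unfolding L_def using P by auto
  have lt: "x i < x j" if "i < j" "j < card P" for i j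
    unfolding x_def using sorted_wrt_nth_less[OF L(2)] that L(3) by simp
  have le: "x i \<le> x j" if "i \<le> j" "j < card P" for i j
    using lt[of i j] that by (cases "i = j") auto
  have xP: "x i \<in> P" if "i < card P" for i using L that by (auto simp: x_def)
  have Px: "\<exists>i<card P. p = x i" if "p \<in> P" for p
    using that L unfolding x_def by (metis in_set_conv_nth)
  have Pn: "p \<notin> supt ?f" if "p \<in> P" for p
    using that orbital_ends_notin unfolding P_def trans_pts_def by blast
  have cov: "{a<..<b} \<subseteq> closure (supt ?f)"
    using ab(2) interior_subset unfolding ext_supt_def by blast
  have orb_in: "a \<le> u \<and> v \<le> b" if "(u, v) \<in> orbitals ?f" for u v
  proof -
    have "{u<..<v} \<subseteq> interior (closure (supt ?f))"
      using orbital_subset[OF that] closure_subset by (intro interior_maximal) auto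
    then have "{u<..<v} \<subseteq> {a<..<b}" using ab(2) by (simp add: ext_supt_def)
    moreover have "u < v" using that by (auto simp: orbitals_def)
    ultimately show ?thesis by (simp add: greaterThanLessThan_subseteq_greaterThanLessThan)
  qed
  have Pin: "a \<le> p \<and> p \<le> b" if "p \<in> P" for p
    using that orb_in unfolding P_def trans_pts_def orbitals_def
    by (smt (verit) case_prodD mem_Collect_eq orb_in orbitals_def)
  have "supt ?f \<noteq> {}" using ab by (auto simp: ext_supt_def)
  then obtain u0 v0 where uv0: "(u0, v0) \<in> orbitals ?f" using supt_orbitals[OF h] by blast
  then have "u0 \<in> P" "v0 \<in> P" "u0 < v0" by (auto simp: P_def trans_pts_def orbitals_def)
  then have c2: "2 \<le> card P"
    using P card_le_Suc0_iff_eq[OF P] by (metis less_irrefl not_less_eq_eq numeral_2_eq_2)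
  define m where "m = card P - 1"
  have gap: "(x k, x (Suc k)) \<in> orbitals ?f" if k: "k < m" for k
  proof -
    have k': "Suc k < card P" using k unfolding m_def by simp
    have "{x k<..<x (Suc k)} \<subseteq> closure (supt ?f)"
      using Pin[OF xP, of k] Pin[OF xP, of "Suc k"] k' cov by (intro order_trans[OF _ cov]) auto
    moreover have "{x k<..<x (Suc k)} \<noteq> {}" using lt[of k "Suc k"] k' by simp
    ultimately have "{x k<..<x (Suc k)} \<inter> supt ?f \<noteq> {}"
      using open_Int_closure_eq_empty[of "{x k<..<x (Suc k)}" "supt ?f"] open_greaterThanLessThan
      by (metis Int_absorb2)
    then obtain z where z: "x k < z" "z < x (Suc k)" "z \<in> supt ?f" by auto
    obtain u v where uv: "(u, v) \<in> orbitals ?f" "u < z" "z < v" using supt_orbitals[OF h z(3)] by blast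
    have uvP: "u \<in> P" "v \<in> P" using uv by (auto simp: P_def trans_pts_def)
    have nin: "\<not> (u < p \<and> p < v)" if "p \<in> P" for p
      using Pn[OF that] orbital_subset[OF uv(1)] by auto
    obtain i j where ij: "i < card P" "u = x i" "j < card P" "v = x j" using Px uvP by metis
    have "i \<le> k" using le[of "Suc k" i] ij uv z by (meson not_less_eq_eq order.strict_trans1 order.asym)
    then have "u \<le> x k" using le[of i k] ij k' by simp
    then have u: "u = x k" using nin[OF xP[of k]] uv z k' by fastforce
    have "Suc k \<le> j" using le[of j k] ij uv z k' by (meson Suc_lessD not_less_eq_eq order.strict_trans1 order.asym)
    then have "x (Suc k) \<le> v" using le[of "Suc k" j] ij by simp
    then have "v = x (Suc k)" using nin[OF xP[of "Suc k"]] uv z k' by fastforce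
    with u uv show ?thesis by simp
  qed
  have "supt ?f = (\<Union>k<m. {x k<..<x (Suc k)})"
  proof
    show "(\<Union>k<m. {x k<..<x (Suc k)}) \<subseteq> supt ?f" using gap orbital_subset by blast
    show "supt ?f \<subseteq> (\<Union>k<m. {x k<..<x (Suc k)})"
    proof
      fix z assume "z \<in> supt ?f"
      then obtain u v where uv: "(u, v) \<in> orbitals ?f" "u < z" "z < v" using supt_orbitals[OF h] by blast
      then have "u \<in> P" "v \<in> P" by (auto simp: P_def trans_pts_def)
      then obtain i j where ij: "i < card P" "u = x i" "j < card P" "v = x j" using Px by metis
      have "i < j" using le[of j i] ij uv by (meson less_trans not_less order.strict_iff_not)
      then have im: "i < m" "Suc i < card P" using ij unfolding m_def by auto
      have "\<not> (u < x (Suc i) \<and> x (Suc i) < v)"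
        using Pn[OF xP[OF im(2)]] orbital_subset[OF uv(1)] by auto
      moreover have "x i < x (Suc i)" using lt[of i "Suc i"] im by simp
      ultimately have "v \<le> x (Suc i)" using ij by simp
      then show "z \<in> (\<Union>k<m. {x k<..<x (Suc k)})" using ij uv im by force
    qed
  qed
  moreover have "strict_mono_on {..m} x" using lt c2 unfolding m_def by (intro strict_mono_onI) auto
  moreover have "0 < m" using c2 unfolding m_def by simp
  ultimately show ?thesis unfolding bumps_def by blast
qed

lemma card_initial_segment:
  assumes "N \<subseteq> {..<m}" "\<And>k i. k \<in> N \<Longrightarrow> i < m \<Longrightarrow> i \<notin> N \<Longrightarrow> k < i" "k < (m :: nat)"
  shows "k \<in> N \<longleftrightarrow> k < card N"
proof
  assume k: "k \<in> N"
  have "{..k} \<subseteq> N"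
  proof
    fix i assume "i \<in> {..k}"
    then show "i \<in> N" using assms(2)[OF k, of i] assms(3) by (cases "i \<in> N") auto
  qed
  then have "card {..k} \<le> card N" using assms(1) by (intro card_mono) (auto intro: finite_subset)
  then show "k < card N" by simp
next
  assume k: "k < card N"
  show "k \<in> N"
  proof (rule ccontr)
    assume "k \<notin> N"
    then have "N \<subseteq> {..<k}" using assms by auto
    then have "card N \<le> card {..<k}" by (intro card_mono) auto
    then show False using k by simp
  qed
qed

text \<open>The negative bumps form an initial segment of the chain, and the condition on the two
  cardinalities says that their number is \<open>m div 2\<close>.\<close>

lemma standard_sign:
  assumes F: "standard F" and b: "bumps (fst F) x m" and k: "k < m"
  shows "positive_on (fst F) (x k, x (Suc k)) \<longleftrightarrow> m div 2 \<le> k"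
proof -
  let ?J = "\<lambda>k. (x k, x (Suc k))"
  define N where "N = {k. k < m \<and> \<not> positive_on (fst F) (?J k)}"
  have neg: "neg_orbitals (fst F) = ?J ` N"
    unfolding neg_orbitals_def bumps_orbitals[OF b] N_def by auto
  have pos: "pos_orbitals (fst F) = ?J ` ({..<m} - N)"
    unfolding pos_orbitals_def bumps_orbitals[OF b] N_def by auto
  have Nm: "N \<subseteq> {..<m}" by (auto simp: N_def)
  then have fN: "finite N" by (rule finite_subset) simp
  have cN: "card (neg_orbitals (fst F)) = card N"
    unfolding neg by (rule card_image) (rule inj_on_subset[OF bumps_inj[OF b] Nm])
  have cP: "card (pos_orbitals (fst F)) = card ({..<m} - N)"
    unfolding pos by (rule card_image) (rule inj_on_subset[OF bumps_inj[OF b]], auto)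
  also have "\<dots> = m - card N" using fN Nm by (simp add: card_Diff_subset)
  finally have cP: "card (pos_orbitals (fst F)) = m - card N" .
  have le: "card N \<le> m" using card_mono[OF _ Nm] by simp
  have "m = 2 * card N \<or> m = 2 * card N + 1"
    using F cN cP le unfolding standard_def by auto
  then have cNm: "card N = m div 2" by auto
  have sep: "i < j" if "i \<in> N" "j < m" "j \<notin> N" for i j
  proof -
    have "?J j \<in> pos_orbitals (fst F)" "?J i \<in> neg_orbitals (fst F)" using that pos neg by auto
    then have "x (Suc i) \<le> x j" using F unfolding standard_def by fastforce
    moreover have "i < m" using that Nm by auto
    ultimately show ?thesis using bumps_less[OF b, of j "Suc i"] by (meson Suc_leI leD le_less_linear less_Suc_eq_le)
  qed
  have "k \<in> N \<longleftrightarrow> k < m div 2"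
    using card_initial_segment[OF Nm sep k] cNm by simp
  then show ?thesis using k by (auto simp: N_def)
qed

section \<open>Feet and standard pairs\<close>

lemma bumps_supt_bounds:
  assumes "bumps f x m" "t \<in> supt f" shows "x 0 < t" "t < x m"
proof -
  obtain k where k: "k < m" "x k < t" "t < x (Suc k)" using bumps_supt_iff[OF assms(1)] assms(2) by blast
  then show "x 0 < t" "t < x m"
    using bumps_le[OF assms(1), of 0 k] bumps_le[OF assms(1), of "Suc k" m] by auto
qed

lemma the_inv_into_finv:
  assumes "homeo f" "s \<in> {0..1}"
  shows "the_inv_into {0..1} f s = finv f s"
proof -
  have "s \<in> f ` {0..1}" using homeo_image assms by simp
  then obtain t where t: "t \<in> {0..1}" "f t = s" by blast
  note b = homeo_bij[OF assms(1)]
  have "inj_on f {0..1}" using b bij_is_inj inj_on_subset by blast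
  then have "the_inv_into {0..1} f s = t" using t by (metis the_inv_into_f_f)
  moreover have "finv f s = t" using b t by (metis bij_inv_eq_iff)
  ultimately show ?thesis by simp
qed

lemma orbital_maps:
  assumes "homeo f" "(u, v) \<in> orbitals f" "u < z" "z < v"
  shows "u < f z" "f z < v" "u < finv f z" "finv f z < v"
proof -
  have "f u = u" "f v = v" using orbital_ends_notin[OF assms(2)] fix_off_supt[OF assms(1)] by auto
  moreover from this have "finv f u = u" "finv f v = v" using inv_fix[OF assms(1)] by auto
  ultimately show "u < f z" "f z < v" "u < finv f z" "finv f z < v"
    using strict_monoD[OF homeo_strict_mono[OF assms(1)], of u z] strict_monoD[OF homeo_strict_mono[OF assms(1)], of z v]
      strict_monoD[OF inv_strict_mono[OF assms(1)], of u z] strict_monoD[OF inv_strict_mono[OF assms(1)], of z v]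
      assms(3,4) by auto
qed

lemma rfoot_start_eq:
  assumes "marked F" "(u, v) \<in> orbitals (fst F)"
  shows "rfoot_start F (u, v) = (if positive_on (fst F) (u, v) then fst F (snd F (u, v))
    else finv (fst F) (snd F (u, v)))"
proof -
  have h: "homeo (fst F)" and s: "u < snd F (u, v)" "snd F (u, v) < v"
    using assms by (auto simp: marked_def)
  have "snd F (u, v) \<in> supt (fst F)" using orbital_subset[OF assms(2)] s by auto
  then show ?thesis
    using the_inv_into_finv[OF h] by (auto simp: rfoot_start_def supt_def)
qed

lemma rfoot_start_bounds:
  assumes "marked F" "(u, v) \<in> orbitals (fst F)"
  shows "snd F (u, v) < rfoot_start F (u, v)" "rfoot_start F (u, v) < v"
proof -
  let ?f = "fst F" and ?s = "snd F (u, v)"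
  have h: "homeo ?f" and s: "u < ?s" "?s < v" using assms by (auto simp: marked_def)
  note m = orbital_maps[OF h assms(2) s]
  show "rfoot_start F (u, v) < v" using m by (simp add: rfoot_start_eq[OF assms])
  show "?s < rfoot_start F (u, v)"
  proof (cases "positive_on ?f (u, v)")
    case True
    then show ?thesis using s by (simp add: rfoot_start_eq[OF assms]) (simp add: positive_on_def)
  next
    case False
    then have "?f (finv ?f ?s) < finv ?f ?s" using orbital_sign[OF h assms(2)] m by auto
    then show ?thesis using homeo_bij[OF h] False
      by (simp add: rfoot_start_eq[OF assms] bij_is_surj surj_f_inv_f)
  qed
qed

lemma Ioo_disjoint: "a < b \<Longrightarrow> c < d \<Longrightarrow> {a<..<b} \<inter> {c<..<d} = {} \<Longrightarrow> b \<le> c \<or> d \<le> (a :: real)"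
proof (rule ccontr)
  assume "a < b" "c < d" "{a<..<b} \<inter> {c<..<d} = {}" "\<not> (b \<le> c \<or> d \<le> a)"
  moreover from this obtain z where "max a c < z" "z < min b d" using dense[of "max a c" "min b d"] by auto
  ultimately show False by auto
qed

lemma feet_disjoint_cases:
  assumes "feet F J \<inter> feet G K = {}"
    and J: "fst J < snd F J" "snd F J < rfoot_start F J" "rfoot_start F J < snd J"
    and K: "fst K < snd G K" "snd G K < rfoot_start G K" "rfoot_start G K < snd K"
  shows "snd F J \<le> fst K \<or> snd G K \<le> fst J"
    and "snd F J \<le> rfoot_start G K \<or> snd K \<le> fst J"
    and "snd G K \<le> rfoot_start F J \<or> snd J \<le> fst K"
    and "snd J \<le> rfoot_start G K \<or> snd K \<le> rfoot_start F J"
proof -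
  let ?l = "\<lambda>F J. {fst J<..<snd F J}" and ?r = "\<lambda>F J. {rfoot_start F J<..<snd J}"
  have "?l F J \<subseteq> feet F J" "?r F J \<subseteq> feet F J" "?l G K \<subseteq> feet G K" "?r G K \<subseteq> feet G K"
    by (auto simp: feet_def)
  then have "?l F J \<inter> ?l G K = {}" "?l F J \<inter> ?r G K = {}" "?r F J \<inter> ?l G K = {}" "?r F J \<inter> ?r G K = {}"
    using assms(1) by blast+
  then show "snd F J \<le> fst K \<or> snd G K \<le> fst J"
    "snd F J \<le> rfoot_start G K \<or> snd K \<le> fst J"
    "snd G K \<le> rfoot_start F J \<or> snd J \<le> fst K"
    "snd J \<le> rfoot_start G K \<or> snd K \<le> rfoot_start F J"
    using Ioo_disjoint J K by blast+
qed

lemma fast_feet_disjoint: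
  assumes "fast S" "F \<in> S" "G \<in> S" "F \<noteq> G" "J \<in> orbitals (fst F)" "K \<in> orbitals (fst G)"
  shows "feet F J \<inter> feet G K = {}"
  using assms unfolding fast_def by blast

text \<open>The assumptions are symmetric in F and G, so a standard pair supplies two instances and
  each fact about the feet of one function serves for both.\<close>

locale fast_pair =
  fixes F G :: mfun and x y :: "nat \<Rightarrow> real" and m n :: nat
  assumes bF: "bumps (fst F) x m" and bG: "bumps (fst G) y n"
    and mF: "marked F" and mG: "marked G"
    and disj: "\<And>J K. J \<in> orbitals (fst F) \<Longrightarrow> K \<in> orbitals (fst G) \<Longrightarrow> feet F J \<inter> feet G K = {}"
begin

abbreviation "sF k \<equiv> snd F (x k, x (Suc k))"
abbreviation "tF k \<equiv> rfoot_start F (x k, x (Suc k))"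
abbreviation "sG k \<equiv> snd G (y k, y (Suc k))"
abbreviation "tG k \<equiv> rfoot_start G (y k, y (Suc k))"

lemma orbF: "k < m \<Longrightarrow> (x k, x (Suc k)) \<in> orbitals (fst F)"
  using bumps_orbitals[OF bF] by auto

lemma orbG: "k < n \<Longrightarrow> (y k, y (Suc k)) \<in> orbitals (fst G)"
  using bumps_orbitals[OF bG] by auto

lemma ordF: "k < m \<Longrightarrow> x k < sF k \<and> sF k < tF k \<and> tF k < x (Suc k)"
  using orbF[of k] rfoot_start_bounds[OF mF orbF[of k]] mF by (auto simp: marked_def)

lemma ordG: "k < n \<Longrightarrow> y k < sG k \<and> sG k < tG k \<and> tG k < y (Suc k)"
  using orbG[of k] rfoot_start_bounds[OF mG orbG[of k]] mG by (auto simp: marked_def)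

lemma feet_cases:
  assumes "k < m" "q < n"
  shows "sF k \<le> y q \<or> sG q \<le> x k" "sF k \<le> tG q \<or> y (Suc q) \<le> x k"
    "sG q \<le> tF k \<or> x (Suc k) \<le> y q" "x (Suc k) \<le> tG q \<or> y (Suc q) \<le> tF k"
  using feet_disjoint_cases[OF disj[OF orbF[OF assms(1)] orbG[OF assms(2)]]]
    ordF[OF assms(1)] ordG[OF assms(2)] by auto

lemma left_ends: "k < m \<Longrightarrow> q < n \<Longrightarrow> x k \<noteq> y q"
  using feet_cases(1)[of k q] ordF[of k] ordG[of q] by auto

lemma right_ends: "k < m \<Longrightarrow> q < n \<Longrightarrow> x (Suc k) \<noteq> y (Suc q)"
  using feet_cases(4)[of k q] ordF[of k] ordG[of q] by auto

text \<open>A left end of G inside a foot of F would make the left foot of G that begins there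
  overlap it. The last point \<open>y n\<close> is only a right end, and there the right foot of G
  ending at it takes this part.\<close>

lemma not_in_left_foot: "k < m \<Longrightarrow> q \<le> n \<Longrightarrow> x k < y q \<Longrightarrow> sF k \<le> y q"
proof (cases "q < n")
  case True
  assume "k < m" "x k < y q"
  with True show ?thesis using feet_cases(1)[of k q] ordG[of q] by auto
next
  case False
  assume k: "k < m" "x k < y q" "q \<le> n"
  then obtain q0 where "q = Suc q0" "q0 < n" using False bG by (cases q) (auto simp: bumps_def)
  with k show ?thesis using feet_cases(2)[of k q0] ordG[of q0] by auto
qed

lemma not_in_right_foot: "k < m \<Longrightarrow> q < n \<Longrightarrow> y q < x (Suc k) \<Longrightarrow> y q < tF k"
  using feet_cases(3)[of k q] ordG[of q] by auto

lemma not_in_right_foot': "k < m \<Longrightarrow> y n < x (Suc k) \<Longrightarrow> y n \<le> tF k"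
  using feet_cases(4)[of k "n - 1"] ordG[of "n - 1"] bG by (auto simp: bumps_def)

text \<open>As no transition point of G is interior to a foot of F, a foot cannot straddle two bumps
  of G. The position of its end at a transition point of F therefore decides for the whole
  foot.\<close>

lemma left_foot_gap:
  assumes "k < m" "right_of y n (x k) g" "z \<in> {x k<..<sF k}"
  shows "case g of None \<Rightarrow> z \<notin> supt (fst G) | Some q \<Rightarrow> q < n \<and> y q < z \<and> z < y (Suc q)"
proof (cases g)
  case None
  show ?thesis
    using None assms bumps_supt_bounds[OF bG, of z] not_in_left_foot[OF assms(1), of 0] by (auto simp: right_of_def)
next
  case (Some q)
  then show ?thesis using assms not_in_left_foot[OF assms(1), of "Suc q"] by (auto simp: right_of_def)
qed

lemma right_foot_gap:
  assumes "k < m" "left_of y n (x (Suc k)) g" "z \<in> {tF k..<x (Suc k)}"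
  shows "case g of None \<Rightarrow> z \<notin> supt (fst G) | Some q \<Rightarrow> q < n \<and> y q < z \<and> z < y (Suc q)"
proof (cases g)
  case None
  show ?thesis
    using None assms bumps_supt_bounds[OF bG, of z] not_in_right_foot'[OF assms(1)] by (auto simp: left_of_def)
next
  case (Some q)
  then show ?thesis using assms not_in_right_foot[OF assms(1), of q] by (auto simp: left_of_def)
qed

end

section \<open>Standard pairs interlace\<close>

lemma bumps_ll:
  assumes "bumps (fst F) x m" "bumps (fst G) y n" "ll F G"
  shows "x m \<le> y 0"
proof (rule ccontr)
  assume "\<not> ?thesis"
  moreover have "x 0 < x m" "y 0 < y n"
    using bumps_less[OF assms(1), of 0 m] bumps_less[OF assms(2), of 0 n] assms by (auto simp: bumps_def)
  ultimately obtain t where t: "y 0 < t" "t < min (y n) (x m)" using dense[of "y 0" "min (y n) (x m)"] by auto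
  then obtain s where s: "max t (x 0) < s" "s < x m" using dense[of "max t (x 0)" "x m"] \<open>x 0 < x m\<close> by auto
  have "s \<in> ext_supt (fst F)" "t \<in> ext_supt (fst G)"
    using s t by (simp_all add: bumps_ext_supt[OF assms(1)] bumps_ext_supt[OF assms(2)])
  then have "s < t" using assms(3) unfolding ll_def by blast
  then show False using s by simp
qed

lemma bumps_sqsub:
  assumes "bumps (fst F) x m" "bumps (fst G) y n" "sqsub F G"
  shows "y 0 < x 0" "x m < y n"
proof -
  have "x 0 < x m" using bumps_less[OF assms(1), of 0 m] assms by (auto simp: bumps_def)
  then have "{x 0..x m} \<subseteq> {y 0<..<y n}"
    using assms(3) unfolding sqsub_def bumps_ext_supt[OF assms(1)] bumps_ext_supt[OF assms(2)] by simp
  then show "y 0 < x 0" "x m < y n" using \<open>x 0 < x m\<close> by (auto simp: subset_iff)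
qed

lemma std_pair_fast: "std_pair F G \<Longrightarrow> standard F \<and> standard G \<and> fast {F, G} \<and> F \<noteq> G"
proof (induction rule: std_pair.induct)
  case (ll_case F G)
  obtain x m where b: "bumps (fst F) x m" using standard_bumps[OF ll_case(1)] by blast
  have "F \<noteq> G" using bumps_ll[OF b, of G x m] b ll_case(4) bumps_less[OF b, of 0 m] by (auto simp: bumps_def)
  with ll_case show ?case by blast
next
  case (sq_case F G H)
  obtain x m where b: "bumps (fst F) x m" using standard_bumps[OF sq_case(1)] by blast
  have "F \<noteq> G" using bumps_sqsub(1)[OF b, of G x m] b sq_case(4) by auto
  with sq_case show ?case by blast
qed

lemma std_pair_fast_pair:
  assumes "std_pair F G" "bumps (fst F) x m" "bumps (fst G) y n"
  shows "fast_pair F G x y m n" "fast_pair G F y x n m"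
proof -
  note f = std_pair_fast[OF assms(1)]
  then have m: "marked F" "marked G" by (simp_all add: standard_def)
  have d: "feet F J \<inter> feet G K = {}" if "J \<in> orbitals (fst F)" "K \<in> orbitals (fst G)" for J K
    using fast_feet_disjoint[of "{F, G}" F G J K] f that by simp
  show "fast_pair F G x y m n" by (rule fast_pair.intro[OF assms(2,3) m d])
  have "feet G K \<inter> feet F J = {}" if "K \<in> orbitals (fst G)" "J \<in> orbitals (fst F)" for J K
    using d[OF that(2,1)] by blast
  then show "fast_pair G F y x n m" by (rule fast_pair.intro[OF assms(3,2) m(2,1)])
qed

lemma circ_bumps:
  assumes "circ G H" "bumps (fst G) y n" "2 < n"
  shows "bumps (fst H) (\<lambda>i. y (i + 1)) (n - 2)"
proof -
  let ?inner = "{J \<in> orbitals (fst G). (\<exists>K\<in>orbitals (fst G). fst K < fst J)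
     \<and> (\<exists>K\<in>orbitals (fst G). fst J < fst K)}"
  have ylt: "y i < y j \<longleftrightarrow> i < j" if "i < n" "j < n" for i j
    using bumps_less[OF assms(2), of i j] bumps_le[OF assms(2), of j i] that by (cases "i < j") auto
  have inner: "?inner = (\<lambda>k. (y k, y (Suc k))) ` {0<..<n - 1}"
  proof (intro Set.set_eqI iffI)
    fix J assume "J \<in> ?inner"
    then obtain k i j where k: "k < n" "J = (y k, y (Suc k))" "i < n" "y i < y k" "j < n" "y k < y j"
      unfolding bumps_orbitals[OF assms(2)] by auto
    then have "i < k" "k < j" using ylt by blast+
    then have "0 < k" "k < n - 1" using k by auto
    then show "J \<in> (\<lambda>k. (y k, y (Suc k))) ` {0<..<n - 1}" using k by auto
  next
    fix J assume "J \<in> (\<lambda>k. (y k, y (Suc k))) ` {0<..<n - 1}"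
    then obtain k where k: "0 < k" "k < n - 1" "J = (y k, y (Suc k))" by auto
    have "y 0 < y k" "y k < y (n - 1)" using k by (auto intro!: bumps_less[OF assms(2)])
    moreover have orb: "(y i, y (Suc i)) \<in> orbitals (fst G)" if "i < n" for i
      using bumps_orbitals[OF assms(2)] that by auto
    ultimately have "J \<in> orbitals (fst G)"
      "(y 0, y (Suc 0)) \<in> orbitals (fst G)" "fst (y 0, y (Suc 0)) < fst J"
      "(y (n - 1), y (Suc (n - 1))) \<in> orbitals (fst G)" "fst J < fst (y (n - 1), y (Suc (n - 1)))"
      using k assms(3) orb[of 0] orb[of k] orb[of "n - 1"] by (simp_all del: Suc_pred Suc_diff_1)
    then show "J \<in> ?inner" by blast
  qed
  have "fst H = (\<lambda>t. if t \<in> (\<Union>J\<in>?inner. {fst J<..<snd J}) then fst G t else t)"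
    using assms(1,3) bumps_card[OF assms(2)] unfolding circ_def Let_def by simp
  then have H: "fst H t = (if \<exists>k. 0 < k \<and> k < n - 1 \<and> y k < t \<and> t < y (Suc k) then fst G t else t)" for t
    unfolding inner by auto
  have "t \<in> supt (fst H) \<longleftrightarrow> (\<exists>i<n - 2. y (i + 1) < t \<and> t < y (Suc i + 1))" for t
  proof
    assume "t \<in> supt (fst H)"
    then obtain k where "0 < k" "k < n - 1" "y k < t" "t < y (Suc k)"
      unfolding supt_def H by (auto split: if_splits)
    then show "\<exists>i<n - 2. y (i + 1) < t \<and> t < y (Suc i + 1)" by (intro exI[of _ "k - 1"]) auto
  next
    assume "\<exists>i<n - 2. y (i + 1) < t \<and> t < y (Suc i + 1)"
    then obtain i where i: "i < n - 2" "y (Suc i) < t" "t < y (Suc (Suc i))" by auto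
    then have "Suc i < n" "0 < Suc i" "Suc i < n - 1" using assms(3) by auto
    then have "t \<in> supt (fst G)" using bumps_supt_iff[OF assms(2), of t] i by blast
    moreover have "fst H t = fst G t"
      using H[of t] i \<open>0 < Suc i\<close> \<open>Suc i < n - 1\<close> by metis
    ultimately show "t \<in> supt (fst H)" by (simp add: supt_def)
  qed
  then have "supt (fst H) = (\<Union>k<n - 2. {y (k + 1)<..<y (Suc k + 1)})"
    by (simp add: set_eq_iff Bex_def)
  moreover have "strict_mono_on {..n - 2} (\<lambda>i. y (i + 1))"
    using assms(3) by (intro strict_mono_onI bumps_less[OF assms(2)]) auto
  ultimately show ?thesis using assms(3) unfolding bumps_def by simp
qed

lemma circ_single_bump:
  assumes "circ G H" "standard G" "bumps (fst G) y n" "n \<le> 2"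
  shows "bumps (fst H) (\<lambda>i. if i = 0 then y (n - 1) else snd G (y (n - 1), y n)) 1"
proof -
  have n: "0 < n" using assms(3) by (simp add: bumps_def)
  obtain J where J: "J \<in> pos_orbitals (fst G)" "supt (fst H) = {fst J<..<snd G J}"
    using assms bumps_card[OF assms(3)] unfolding circ_def by auto
  then obtain k where k: "k < n" "J = (y k, y (Suc k))" "positive_on (fst G) J"
    using bumps_orbitals[OF assms(3)] by (auto simp: pos_orbitals_def)
  then have "n div 2 \<le> k" using standard_sign[OF assms(2,3) k(1)] by simp
  then have "k = n - 1" using k(1) assms(4) n by linarith
  then have J': "J = (y (n - 1), y n)" using k n by simp
  have "J \<in> orbitals (fst G)" using J by (simp add: pos_orbitals_def)
  then have "y (n - 1) < snd G (y (n - 1), y n)"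
    using assms(2) J' by (auto simp: standard_def marked_def)
  then show ?thesis using J J' unfolding bumps_def by (auto intro!: strict_mono_onI simp: lessThan_Suc)
qed

text \<open>Case \<open>ll\<close> has depth 0, and every \<open>sqsub\<close> step wraps one more
  layer around the pair \<open>(H, F)\<close>. With more than two bumps this is
  \<open>interlaced_Suc\<close>; otherwise H is supported on a left foot of G, whose right end is a
  marker rather than a transition point, and the possible depths are treated one by one.\<close>

lemma std_pair_interlaced:
  assumes "std_pair F G" "bumps (fst F) x m" "bumps (fst G) y n"
  shows "\<exists>d. interlaced d x m y n \<and> d \<le> n \<and> d \<le> m + 1"
  using assms
proof (induction arbitrary: x m y n rule: std_pair.induct)
  case (ll_case F G)
  then show ?case using bumps_ll by (intro exI[of _ 0]) auto
next
  case (sq_case F G H)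
  have n0: "0 < n" and m0: "0 < m" using sq_case.prems by (auto simp: bumps_def)
  have FG: "std_pair F G" by (rule std_pair.sq_case[OF sq_case.hyps])
  note b = bumps_sqsub[OF sq_case.prems sq_case.hyps(4)]
  show ?case
  proof (cases "2 < n")
    case True
    define z where "z = (\<lambda>i. y (i + 1))"
    have "bumps (fst H) z (n - 2)"
      unfolding z_def using circ_bumps[OF sq_case.hyps(5) sq_case.prems(2) True] .
    from sq_case.IH[OF this sq_case.prems(1)] obtain d where
      d: "interlaced d z (n - 2) x m" "d \<le> m" "d \<le> n - 2 + 1" by blast
    have "z i = y (i + 1) \<and> z (n - 2 - i) = y (n - (i + 1))" if "i \<le> d div 2" for i
    proof -
      have "i \<le> n - 2" using that d True by linarith
      then show ?thesis unfolding z_def using True by (auto intro!: arg_cong[of _ _ y])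
    qed
    then have "interlaced (Suc d) x m y n" using interlaced_Suc[of d z y "n - 2" n x m] b d by blast
    then show ?thesis using d True by (intro exI[of _ "Suc d"]) auto
  next
    case False
    define s where "s = snd G (y (n - 1), y n)"
    define z where "z = (\<lambda>i :: nat. if i = 0 then y (n - 1) else s)"
    have z: "bumps (fst H) z 1"
      unfolding z_def s_def using circ_single_bump[OF sq_case.hyps(5,2) sq_case.prems(2)] False by simp
    from sq_case.IH[OF z sq_case.prems(1)] obtain d where
      d: "interlaced d z 1 x m" "d \<le> m" "d \<le> 2" by auto
    interpret GF: fast_pair G F y x n m using std_pair_fast_pair(2)[OF FG sq_case.prems] .
    have s: "s = GF.sF (n - 1)" "Suc (n - 1) = n" using n0 by (simp_all add: s_def)
    have ys: "y (n - 1) < s" using GF.ordF[of "n - 1"] n0 s by simp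
    consider "d = 0" | "d = 1" | "d = 2" using d(3) by linarith
    then show ?thesis
    proof cases
      case 1
      then have "y (n - 1) \<le> x 0" using d ys by (simp add: z_def)
      then have "interlaced (Suc 0) x m y n" using b unfolding interlaced_def by auto
      then show ?thesis using n0 by (intro exI[of _ "Suc 0"]) auto
    next
      case 2
      have *: "x 0 < y (n - 1)" "s < x m" "x (m - 1) \<le> y (n - 1)"
        using interlacedD(1,2)[OF d(1), of 0] interlacedD(6)[OF d(1), of 0] 2 by (auto simp: z_def)
      have n2: "n = 2"
      proof (rule ccontr)
        assume "n \<noteq> 2"
        then have "n = 1" using False n0 by simp
        then show False using *(1) b by simp
      qed
      \<comment> \<open>The marker s is dropped: the inner part of \<open>y 0, y 1, y 2\<close> is
        the single point \<open>y 1\<close>, and the inequalities of depth 1 hold for this one-term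
        sequence.\<close>
      have "interlaced 1 (\<lambda>_. y 1) 0 x m"
        using * ys n2 unfolding interlaced_def by auto
      then have "interlaced (Suc 1) x m y n"
        using interlaced_Suc[of 1 "\<lambda>_. y 1" y 0 n x m] b n2 by simp
      then show ?thesis using n2 m0 by (intro exI[of _ 2]) (auto simp: numeral_2_eq_2)
    next
      case 3
      \<comment> \<open>Depth 2 would put \<open>x 1\<close> strictly inside the left foot of the
        positive bump of G, which fastness forbids.\<close>
      have *: "y (n - 1) < x 1" "x (m - 1) < s"
        using interlacedD(3,4)[OF d(1), of 0] 3 by (auto simp: z_def)
      have "x 1 \<le> x (m - 1)" using d(2) 3 by (intro bumps_le[OF sq_case.prems(1)]) auto
      then have "x 1 < s" using * by simp
      moreover have "s \<le> x 1"
        using GF.not_in_left_foot[of "n - 1" 1] n0 m0 * s by simp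
      ultimately show ?thesis by simp
    qed
  qed
qed

lemma loc_range:
  assumes "loc d m n k = Some q" "d \<le> n" "k \<le> m"
  shows "q < d div 2 \<or> n - (d + 1) div 2 \<le> q"
proof -
  have "d div 2 \<le> (d + 1) div 2" "odd d \<Longrightarrow> (d + 1) div 2 = d div 2 + 1" "even d \<Longrightarrow> d \<noteq> 0 \<Longrightarrow> 0 < d div 2"
    by (auto elim!: oddE evenE)
  with assms show ?thesis unfolding loc_def by (auto split: if_splits)
qed

text \<open>The bumps of G that contain a point of x are the first \<open>d div 2\<close> and the
  last \<open>(d + 1) div 2\<close>. \<open>interlaced_loc\<close> shows that there are no others;
  the interlacing inequalities supply a point in each of these.\<close>

lemma osc_interlaced:
  assumes bF: "bumps (fst F) x m" and bG: "bumps (fst G) y n"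
    and I: "interlaced d x m y n" and d: "d \<le> n" "d \<le> m + 1"
    and ends: "\<And>k q. k < m \<Longrightarrow> q < n \<Longrightarrow> x k \<noteq> y q"
  shows "osc F G = d"
proof -
  let ?J = "\<lambda>q. (y q, y (Suc q))"
  define Q where "Q = {q. q < n \<and> (\<exists>k\<le>m. y q < x k \<and> x k < y (Suc q))}"
  have m0: "0 < m" and n0: "0 < n" using bF bG by (auto simp: bumps_def)
  have "{J \<in> orbitals (fst G). \<exists>p\<in>trans_pts (fst F). fst J < p \<and> p < snd J} = ?J ` Q"
    unfolding bumps_orbitals[OF bG] bumps_trans_pts[OF bF] Q_def
    by (auto intro!: image_eqI[OF refl])
  then have "osc F G = card (?J ` Q)" by (simp add: osc_def)
  also have "\<dots> = card Q"
    by (rule card_image) (rule inj_on_subset[OF bumps_inj[OF bG]], auto simp: Q_def)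
  also have "Q = {..<d div 2} \<union> {n - (d + 1) div 2..<n}"
  proof (intro subset_antisym subsetI)
    fix q assume "q \<in> Q"
    then obtain k where k: "q < n" "k \<le> m" "y q < x k" "x k < y (Suc q)" by (auto simp: Q_def)
    then have s: "x k \<in> supt (fst G)" using bumps_supt_iff[OF bG] by blast
    have ne: "x k \<noteq> y q'" if "q' \<le> n" for q' using s bumps_pt_notin[OF bG that] by auto
    have "strict_mono_on {..m} x" using bF by (simp add: bumps_def)
    then have r: "right_of y n (x k) (loc d m n k)"
      using interlaced_loc(1)[OF I _ d n0 k(2)] ne by simp
    then obtain q' where q': "loc d m n k = Some q'" "q' < n" "y q' \<le> x k" "x k < y (Suc q')"
      using bumps_supt_bounds[OF bG s] by (auto simp: right_of_def split: option.splits)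
    have "q' = q"
      using bumps_gap_unique[OF bG q'(2) k(1) _ q'(4) k(3,4)] q'(2,3) ne[of q'] by simp
    then show "q \<in> {..<d div 2} \<union> {n - (d + 1) div 2..<n}"
      using loc_range[OF q'(1) d(1) k(2)] k(1) by auto
  next
    fix q assume "q \<in> {..<d div 2} \<union> {n - (d + 1) div 2..<n}"
    then consider "q < d div 2" | "n - (d + 1) div 2 \<le> q" "q < n" by auto
    then show "q \<in> Q"
    proof cases
      case 1
      then have "2 * q + 2 \<le> d" by linarith
      then show ?thesis using interlacedD(1,3)[OF I, of q] d unfolding Q_def
        by (auto intro!: exI[of _ q])
    next
      case 2
      define i where "i = n - 1 - q"
      have i: "i < n" "n - (i + 1) = q" "n - i = Suc q" "i < (d + 1) div 2" using 2 d n0 unfolding i_def by linarith+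
      show ?thesis
      proof (cases "2 * i + 2 \<le> d")
        case True
        then show ?thesis using interlacedD(2,4)[OF I, of i] i 2 unfolding Q_def
          by (auto intro!: exI[of _ "m - i"])
      next
        case False
        \<comment> \<open>The innermost bump on the right for odd d: here the interlacing gives only
          a weak inequality at its left end, and equality is excluded because two left ends never
          coincide.\<close>
        then have di: "d = 2 * i + 1" using i(4) by linarith
        have im: "i < m" "i \<le> m - i" using di d m0 by linarith+
        have "x i \<le> x (m - i)" using im by (intro bumps_le[OF bF]) auto
        also have "\<dots> < y (Suc q)" using interlacedD(2)[OF I, of i] di i by simp
        finally have "x i < y (Suc q)" .
        moreover have "y q \<le> x i" using interlacedD(6)[OF I di] i by simp
        ultimately show ?thesis using ends[OF im(1) 2(2)] im 2 unfolding Q_def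
          by (auto intro!: exI[of _ i])
      qed
    qed
  qed
  also have "card \<dots> = d div 2 + (d + 1) div 2"
  proof -
    have "{..<d div 2} \<inter> {n - (d + 1) div 2..<n} = {}" "(d + 1) div 2 \<le> n" using d by auto
    then show ?thesis by (simp add: card_Un_disjoint)
  qed
  also have "\<dots> = d" by linarith
  finally show ?thesis .
qed

text \<open>The foot into which the letter with sign e pushes the points of the orbital J.\<close>
definition att_foot :: "mfun \<Rightarrow> real \<times> real \<Rightarrow> bool \<Rightarrow> real set" where
  "att_foot F J e = (if e = positive_on (fst F) J then {rfoot_start F J..<snd J} else {fst J<..<snd F J})"

definition dir :: "(real \<Rightarrow> real) \<Rightarrow> bool \<Rightarrow> real \<Rightarrow> real" where
  "dir f e = (if e then f else finv f)"

lemma dir_dir: "homeo f \<Longrightarrow> dir f (\<not> e) (dir f e t) = t"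
  using homeo_bij[of f] by (auto simp: dir_def bij_is_inj bij_is_surj surj_f_inv_f)

lemma dir_mono: "homeo f \<Longrightarrow> s < t \<Longrightarrow> dir f e s < dir f e t"
  using strict_monoD[OF homeo_strict_mono, of f s t] strict_monoD[OF inv_strict_mono, of f s t]
  by (simp add: dir_def)

lemma dir_fix: "homeo f \<Longrightarrow> t \<notin> supt f \<Longrightarrow> dir f e t = t"
  using fix_off_supt[of f t] inv_fix[of f t] by (simp add: dir_def)

lemma feet_att_foot: "feet F J = att_foot F J e \<union> att_foot F J (\<not> e)"
  by (auto simp: feet_def att_foot_def)

context
  fixes F :: mfun and u v :: real
  assumes F: "marked F" and J: "(u, v) \<in> orbitals (fst F)"
begin

lemma att_foot_subset: "att_foot F (u, v) e \<subseteq> {u<..<v}"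
proof -
  have "u < snd F (u, v)" "snd F (u, v) < v" using F J by (auto simp: marked_def)
  then show ?thesis using rfoot_start_bounds[OF F J] by (auto simp: att_foot_def)
qed

lemma att_foot_disjoint: "att_foot F (u, v) e \<inter> att_foot F (u, v) (\<not> e) = {}"
  using rfoot_start_bounds[OF F J] by (auto simp: att_foot_def)

text \<open>The generator moves the marker and the start of the right foot to one another, so the
  interval between them is a fundamental domain. One step in direction e takes everything outside
  the source foot across it, and one step back leaves the opposite foot empty of images.\<close>

lemma att_foot_push:
  "u < z \<Longrightarrow> z < v \<Longrightarrow> z \<notin> att_foot F (u, v) (\<not> e) \<Longrightarrow> dir (fst F) e z \<in> att_foot F (u, v) e"
  and att_foot_pull:
  "z \<in> att_foot F (u, v) e \<Longrightarrow> u < dir (fst F) (\<not> e) z \<and> dir (fst F) (\<not> e) z < v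
     \<and> dir (fst F) (\<not> e) z \<notin> att_foot F (u, v) (\<not> e)"
proof -
  let ?f = "fst F" and ?s = "snd F (u, v)" and ?t = "rfoot_start F (u, v)"
  have h: "homeo ?f" using F by (simp add: marked_def)
  have s: "u < ?s" "?s < v" using F J by (auto simp: marked_def)
  note t = rfoot_start_bounds[OF F J]
  note bij = homeo_bij[OF h]
  have ff: "?f (finv ?f a) = a" for a using bij by (simp add: bij_is_surj surj_f_inv_f)
  have less: "?f a < ?f b \<longleftrightarrow> a < b" for a b using strict_mono_less[OF homeo_strict_mono[OF h]] .
  have gal: "finv ?f a < b \<longleftrightarrow> a < ?f b" for a b using less[of "finv ?f a" b] ff by simp
  have tp: "?t = ?f ?s" if "positive_on ?f (u, v)" using that by (simp add: rfoot_start_eq[OF F J])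
  have tn: "?s = ?f ?t" if "\<not> positive_on ?f (u, v)" using that ff by (simp add: rfoot_start_eq[OF F J])
  note m = orbital_maps[OF h J]
  show "u < z \<Longrightarrow> z < v \<Longrightarrow> z \<notin> att_foot F (u, v) (\<not> e) \<Longrightarrow> dir ?f e z \<in> att_foot F (u, v) e"
  proof (cases "positive_on ?f (u, v)")
    case True
    assume "u < z" "z < v" "z \<notin> att_foot F (u, v) (\<not> e)"
    then show ?thesis using m[of z] less[of z ?s] gal[of z ?s] True tp[OF True]
      by (cases e) (auto simp: att_foot_def dir_def not_less)
  next
    case False
    assume "u < z" "z < v" "z \<notin> att_foot F (u, v) (\<not> e)"
    then show ?thesis using m[of z] less[of z ?t] gal[of z ?t] False tn[OF False]
      by (cases e) (auto simp: att_foot_def dir_def not_less)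
  qed
  show "u < dir ?f (\<not> e) z \<and> dir ?f (\<not> e) z < v \<and> dir ?f (\<not> e) z \<notin> att_foot F (u, v) (\<not> e)"
    if z: "z \<in> att_foot F (u, v) e"
  proof (cases "positive_on ?f (u, v)")
    case True
    have "u < z" "z < v" using subsetD[OF att_foot_subset z] by auto
    then show ?thesis using m[of z] less[of z ?s] gal[of z ?s] True tp[OF True] z
      by (cases e) (auto simp: att_foot_def dir_def not_less)
  next
    case False
    have "u < z" "z < v" using subsetD[OF att_foot_subset z] by auto
    then show ?thesis using m[of z] less[of z ?t] gal[of z ?t] False tn[OF False] z
      by (cases e) (auto simp: att_foot_def dir_def not_less)
  qed
qed

lemma marker_not_in_foot: "snd F (u, v) \<notin> att_foot F (u, v) e"
  using rfoot_start_bounds[OF F J] by (auto simp: att_foot_def)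

text \<open>The image of the marker: it enters the foot in a single step from a point that lies in
  neither foot. Moving a foot point once more gives the deep point of the next lemma.\<close>

lemma att_foot_shallow: "\<exists>z\<in>att_foot F (u, v) e. dir (fst F) (\<not> e) z \<notin> att_foot F (u, v) e"
proof -
  have h: "homeo (fst F)" and "u < snd F (u, v)" "snd F (u, v) < v" using F J by (auto simp: marked_def)
  then have "dir (fst F) e (snd F (u, v)) \<in> att_foot F (u, v) e"
    using att_foot_push marker_not_in_foot by blast
  moreover have "dir (fst F) (\<not> e) (dir (fst F) e (snd F (u, v))) \<notin> att_foot F (u, v) e"
    using dir_dir[OF h] marker_not_in_foot by simp
  ultimately show ?thesis by blast
qed

lemma att_foot_deep: "\<exists>z\<in>att_foot F (u, v) e. dir (fst F) (\<not> e) z \<in> att_foot F (u, v) e"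
proof -
  have h: "homeo (fst F)" using F by (simp add: marked_def)
  obtain z where z: "z \<in> att_foot F (u, v) e" using att_foot_shallow by blast
  then have "u < z" "z < v" "z \<notin> att_foot F (u, v) (\<not> e)"
    using subsetD[OF att_foot_subset z] att_foot_disjoint[of e] by auto
  then have "dir (fst F) e z \<in> att_foot F (u, v) e" using att_foot_push by blast
  moreover have "dir (fst F) (\<not> e) (dir (fst F) e z) \<in> att_foot F (u, v) e" using dir_dir[OF h] z by simp
  ultimately show ?thesis by blast
qed

end

section \<open>The ping-pong system of a standard set\<close>

type_synonym 'i label = "'i \<times> nat \<times> bool"

definition label_letter :: "'i label \<Rightarrow> 'i letter" where
  "label_letter l = (case l of (i, k, b) \<Rightarrow> (i, b))"

lemma label_letter_simp [simp]: "label_letter (i, k, b) = (i, b)"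
  by (simp add: label_letter_def)

text \<open>The functions are indexed by a separate set, with order and oscillations as data on the
  indices. Two standard sets of the same signature then share their letters, \<open>prec\<close> and
  \<open>w\<close>.\<close>

locale std_world =
  fixes A :: "'i set" and e :: "'i \<Rightarrow> mfun" and prec :: "'i \<Rightarrow> 'i \<Rightarrow> bool" and w :: "'i \<Rightarrow> 'i \<Rightarrow> nat"
  assumes finite_A: "finite A"
    and std: "\<And>i. i \<in> A \<Longrightarrow> standard (e i)"
    and total: "\<And>i j. i \<in> A \<Longrightarrow> j \<in> A \<Longrightarrow> i \<noteq> j \<Longrightarrow> prec i j \<or> prec j i"
    and pair: "\<And>i j. i \<in> A \<Longrightarrow> j \<in> A \<Longrightarrow> i \<noteq> j \<Longrightarrow> prec i j \<Longrightarrow> std_pair (e i) (e j)"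
    and osc: "\<And>i j. i \<in> A \<Longrightarrow> j \<in> A \<Longrightarrow> i \<noteq> j \<Longrightarrow> prec i j \<Longrightarrow> osc (e i) (e j) = w i j"
begin

definition seq :: "'i \<Rightarrow> (nat \<Rightarrow> real) \<times> nat" where
  "seq i = (SOME p. bumps (fst (e i)) (fst p) (snd p))"

abbreviation "pts i \<equiv> fst (seq i)"
abbreviation "num i \<equiv> snd (seq i)"

definition "orb i k = (pts i k, pts i (Suc k))"

definition labels :: "'i label set" where
  "labels = {(i, k, b). i \<in> A \<and> k < num i}"

definition foot :: "'i label \<Rightarrow> real set" where
  "foot l = (case l of (i, k, b) \<Rightarrow> att_foot (e i) (orb i k) b)"

definition act :: "'i letter \<Rightarrow> real \<Rightarrow> real" where
  "act a = dir (fst (e (fst a))) (snd a)"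

text \<open>The index of the end point of the k-th bump at which its foot with sign b lies.\<close>
definition pt_idx :: "'i \<Rightarrow> nat \<Rightarrow> bool \<Rightarrow> nat" where
  "pt_idx i k b = (if b = (num i div 2 \<le> k) then Suc k else k)"

text \<open>Beyond the order and the signature this uses only the numbers of bumps, no coordinates.
  It is the reason why the transition rule \<open>nxt\<close> can be compared between two
  sets.\<close>

definition gap :: "'i \<Rightarrow> 'i \<Rightarrow> nat \<Rightarrow> nat option" where
  "gap i j t = (if prec i j then loc (w i j) (num i) (num j) t else loc_outer (w j i) (num j) (num i) t)"

definition nxt :: "'i label \<Rightarrow> 'i letter \<Rightarrow> 'i label option" where
  "nxt l a = (case l of (i, k, b) \<Rightarrow> if i = fst a then Some (i, k, snd a)
     else map_option (\<lambda>q. (fst a, q, snd a)) (gap i (fst a) (pt_idx i k b)))"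

lemma bumps_seq: "i \<in> A \<Longrightarrow> bumps (fst (e i)) (pts i) (num i)"
  unfolding seq_def using standard_bumps[OF std]
  by (metis (mono_tags, lifting) fst_conv snd_conv someI_ex)

lemma marked_e: "i \<in> A \<Longrightarrow> marked (e i)"
  using std by (simp add: standard_def)

lemma homeo_e: "i \<in> A \<Longrightarrow> homeo (fst (e i))"
  using marked_e by (simp add: marked_def)

lemma orb_orbital: "i \<in> A \<Longrightarrow> k < num i \<Longrightarrow> (pts i k, pts i (Suc k)) \<in> orbitals (fst (e i))"
  using bumps_orbitals[OF bumps_seq] by auto

lemma pair_fast:
  assumes "i \<in> A" "j \<in> A" "i \<noteq> j"
  shows "fast_pair (e i) (e j) (pts i) (pts j) (num i) (num j)"
proof (cases "prec i j")
  case True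
  then show ?thesis using std_pair_fast_pair(1)[OF pair bumps_seq bumps_seq] assms by blast
next
  case False
  then have "prec j i" using total assms by blast
  then show ?thesis using std_pair_fast_pair(2)[OF pair bumps_seq bumps_seq] assms by blast
qed

text \<open>The depth of interlacing obtained from the recursion equals the oscillation, so the
  signature prescribes it.\<close>

lemma pair_interlaced:
  assumes ij: "i \<in> A" "j \<in> A" "i \<noteq> j" "prec i j"
  shows "interlaced (w i j) (pts i) (num i) (pts j) (num j)" "w i j \<le> num j" "w i j \<le> num i + 1"
proof -
  note b = bumps_seq[OF ij(1)] bumps_seq[OF ij(2)]
  obtain d where d: "interlaced d (pts i) (num i) (pts j) (num j)" "d \<le> num j" "d \<le> num i + 1"
    using std_pair_interlaced[OF pair[OF ij] b] by blast
  have "osc (e i) (e j) = d"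
    using osc_interlaced[OF b d] fast_pair.left_ends[OF pair_fast[OF ij(1-3)]] by blast
  then have "d = w i j" using osc[OF ij] by simp
  then show "interlaced (w i j) (pts i) (num i) (pts j) (num j)" "w i j \<le> num j" "w i j \<le> num i + 1"
    using d by auto
qed

lemma num_pos: "i \<in> A \<Longrightarrow> 0 < num i"
  using bumps_seq by (auto simp: bumps_def)

lemma strict_pts: "i \<in> A \<Longrightarrow> strict_mono_on {..num i} (pts i)"
  using bumps_seq by (auto simp: bumps_def)

text \<open>The bridge from geometry to indices: fastness reduces a foot to its end point, and the
  interlacing locates that point in the other function.\<close>

lemma foot_gap:
  assumes ij: "i \<in> A" "j \<in> A" "i \<noteq> j" and k: "k < num i" and z: "z \<in> foot (i, k, b)"
  shows "case gap i j (pt_idx i k b) of None \<Rightarrow> z \<notin> supt (fst (e j))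
    | Some q \<Rightarrow> q < num j \<and> pts j q < z \<and> z < pts j (Suc q)"
proof -
  interpret P: fast_pair "e i" "e j" "pts i" "pts j" "num i" "num j" by (rule pair_fast[OF ij])
  have ends: "\<forall>q<num j. pts i k \<noteq> pts j q" "\<forall>q\<in>{1..num j}. pts i (Suc k) \<noteq> pts j q"
  proof -
    show "\<forall>q<num j. pts i k \<noteq> pts j q" using P.left_ends k by blast
    show "\<forall>q\<in>{1..num j}. pts i (Suc k) \<noteq> pts j q"
    proof
      fix q assume "q \<in> {1..num j}"
      then obtain q0 where "q = Suc q0" "q0 < num j" by (cases q) auto
      then show "pts i (Suc k) \<noteq> pts j q" using P.right_ends k by blast
    qed
  qed
  have gaps: "right_of (pts j) (num j) (pts i k) (gap i j k)"
    "left_of (pts j) (num j) (pts i (Suc k)) (gap i j (Suc k))"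
  proof -
    have "right_of (pts j) (num j) (pts i k) (gap i j k) \<and>
      left_of (pts j) (num j) (pts i (Suc k)) (gap i j (Suc k))"
    proof (cases "prec i j")
      case True
      note I = pair_interlaced[OF ij True]
      show ?thesis
        using interlaced_loc(1)[OF I(1) strict_pts[OF ij(1)] I(2,3) num_pos[OF ij(2)], of k]
          interlaced_loc(2)[OF I(1) strict_pts[OF ij(1)] I(2,3) num_pos[OF ij(2)], of "Suc k"] ends k True
        by (simp add: gap_def)
    next
      case False
      then have "prec j i" using total ij by blast
      note I = pair_interlaced[OF ij(2,1) ij(3)[symmetric] this]
      show ?thesis
        using interlaced_loc_outer(1)[OF I(1) strict_pts[OF ij(1)] I(2,3) num_pos[OF ij(2)] num_pos[OF ij(1)], of k]
          interlaced_loc_outer(2)[OF I(1) strict_pts[OF ij(1)] I(2,3) num_pos[OF ij(2)] num_pos[OF ij(1)], of "Suc k"]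
          ends k False
        by (simp add: gap_def)
    qed
    then show "right_of (pts j) (num j) (pts i k) (gap i j k)"
      "left_of (pts j) (num j) (pts i (Suc k)) (gap i j (Suc k))" by blast+
  qed
  have sgn: "positive_on (fst (e i)) (pts i k, pts i (Suc k)) \<longleftrightarrow> num i div 2 \<le> k"
    using standard_sign[OF std bumps_seq k] ij by blast
  show ?thesis
  proof (cases "b = (num i div 2 \<le> k)")
    case True
    then have "z \<in> {P.tF k..<pts i (Suc k)}" "pt_idx i k b = Suc k"
      using z sgn by (auto simp: foot_def att_foot_def orb_def pt_idx_def)
    then show ?thesis using P.right_foot_gap[OF k gaps(2)] by simp
  next
    case False
    then have "z \<in> {pts i k<..<P.sF k}" "pt_idx i k b = k"
      using z sgn by (auto simp: foot_def att_foot_def orb_def pt_idx_def)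
    then show ?thesis using P.left_foot_gap[OF k gaps(1)] by simp
  qed
qed

lemma foot_orb: "i \<in> A \<Longrightarrow> k < num i \<Longrightarrow> z \<in> foot (i, k, b) \<Longrightarrow> pts i k < z \<and> z < pts i (Suc k)"
  using att_foot_subset[OF marked_e orb_orbital] by (fastforce simp: foot_def orb_def)

lemma foot_disj:
  assumes "l \<in> labels" "l' \<in> labels" "z \<in> foot l" "z \<in> foot l'"
  shows "l = l'"
proof -
  obtain i k b j q c where l: "l = (i, k, b)" "l' = (j, q, c)" by (cases l; cases l')
  have i: "i \<in> A" "k < num i" "j \<in> A" "q < num j" using assms l by (auto simp: labels_def)
  have "i = j"
  proof (rule ccontr)
    assume ne: "i \<noteq> j"
    have "z \<in> feet (e i) (pts i k, pts i (Suc k))" "z \<in> feet (e j) (pts j q, pts j (Suc q))"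
      using assms l feet_att_foot[of "e i" _ b] feet_att_foot[of "e j" _ c]
      by (auto simp: foot_def orb_def)
    then show False
      using fast_pair.disj[OF pair_fast[OF i(1,3) ne] orb_orbital[OF i(1,2)] orb_orbital[OF i(3,4)]] by blast
  qed
  moreover have "k = q"
    using bumps_gap_unique[OF bumps_seq[OF i(1)] i(2), of q z] foot_orb[OF i(1,2), of z b]
      foot_orb[OF i(3,4), of z c] assms l i calculation by simp
  moreover have "b = c"
    using att_foot_disjoint[OF marked_e[OF i(1)] orb_orbital[OF i(1,2)], of b] assms l calculation
    by (auto simp: foot_def orb_def)
  ultimately show ?thesis using l by simp
qed

lemma act_push:
  assumes "j \<in> A" "q < num j" "pts j q < z" "z < pts j (Suc q)" "z \<notin> foot (j, q, \<not> c)"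
  shows "act (j, c) z \<in> foot (j, q, c)"
  using att_foot_push[OF marked_e[OF assms(1)] orb_orbital[OF assms(1,2)] assms(3,4)] assms(5)
  by (simp add: act_def foot_def orb_def)

sublocale pingpong A act labels foot label_letter nxt
proof unfold_locales
  show "finite A" by (rule finite_A)
  fix a :: "'i letter" and x assume a: "fst a \<in> A"
  show "act (linv a) (act a x) = x"
    using dir_dir[OF homeo_e[OF a]] by (simp add: act_def linv_def)
next
  fix a :: "'i letter" and x y :: real assume a: "fst a \<in> A" and xy: "x < y"
  show "act a x < act a y" using dir_mono[OF homeo_e[OF a] xy] by (simp add: act_def)
next
  fix l :: "'i label" assume "l \<in> labels"
  then show "fst (label_letter l) \<in> A" by (auto simp: labels_def)
next
  fix l k :: "'i label" and x assume "l \<in> labels" "k \<in> labels" "x \<in> foot l" "x \<in> foot k"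
  then show "l = k" by (rule foot_disj)
next
  fix l k :: "'i label" and a
  assume l: "l \<in> labels" and a: "fst a \<in> A" "a \<noteq> linv (label_letter l)" and n: "nxt l a = Some k"
  obtain i k0 b where l': "l = (i, k0, b)" "i \<in> A" "k0 < num i" using l by (auto simp: labels_def)
  \<comment> \<open>Any point of the foot serves; \<open>foot_gap\<close> needs one to yield that
    the index lies in range.\<close>
  obtain z where z: "z \<in> foot l"
    using att_foot_deep[OF marked_e[OF l'(2)] orb_orbital[OF l'(2,3)], of b] l' by (auto simp: foot_def orb_def)
  show "k \<in> labels \<and> label_letter k = a"
  proof (cases "i = fst a")
    case True
    then show ?thesis using n l' by (auto simp: nxt_def labels_def)
  next
    case False
    then obtain q where q: "gap i (fst a) (pt_idx i k0 b) = Some q" "k = (fst a, q, snd a)"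
      using n l' by (auto simp: nxt_def)
    then show ?thesis using foot_gap[OF l'(2) a(1) False l'(3), of z b] z l' a by (auto simp: labels_def)
  qed
next
  fix l k :: "'i label" and a x
  assume l: "l \<in> labels" and a: "fst a \<in> A" "a \<noteq> linv (label_letter l)" and n: "nxt l a = Some k"
    and x: "x \<in> foot l"
  obtain i k0 b where l': "l = (i, k0, b)" "i \<in> A" "k0 < num i" using l by (auto simp: labels_def)
  obtain j c where jc: "a = (j, c)" by (cases a)
  show "act a x \<in> foot k"
  proof (cases "i = j")
    case True
    then have c: "c = b" "k = l" using a n l' jc by (auto simp: nxt_def linv_def)
    have "x \<notin> foot (i, k0, \<not> b)" using foot_disj[OF l, of "(i, k0, \<not> b)" x] x l' by (auto simp: labels_def)
    then show ?thesis using act_push[OF l'(2,3), of x b] foot_orb[OF l'(2,3), of x b] x l' c jc True by simp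
  next
    case False
    then obtain q where q: "gap i j (pt_idx i k0 b) = Some q" "k = (j, q, c)"
      using n l' jc by (auto simp: nxt_def)
    have j: "j \<in> A" using a jc by simp
    from foot_gap[OF l'(2) j False l'(3), of x b] x l' q
    have xq: "q < num j" "pts j q < x" "x < pts j (Suc q)" by auto
    have "x \<notin> foot (j, q, \<not> c)"
      using foot_disj[OF l, of "(j, q, \<not> c)" x] x l' xq j False by (auto simp: labels_def)
    then show ?thesis using act_push[OF j xq, of c] q jc by simp
  qed
next
  fix l :: "'i label" and a x
  assume l: "l \<in> labels" and a: "fst a \<in> A" "a \<noteq> linv (label_letter l)" and n: "nxt l a = None"
    and x: "x \<in> foot l"
  obtain i k0 b where l': "l = (i, k0, b)" "i \<in> A" "k0 < num i" using l by (auto simp: labels_def)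
  have ne: "i \<noteq> fst a" and g: "gap i (fst a) (pt_idx i k0 b) = None" using n l' by (auto simp: nxt_def split: if_splits)
  have "x \<notin> supt (fst (e (fst a)))" using foot_gap[OF l'(2) a(1) ne l'(3), of x b] x l' g by simp
  then show "act a x = x" using dir_fix[OF homeo_e[OF a(1)]] by (simp add: act_def)
next
  fix l k :: "'i label" and x
  assume l: "l \<in> labels" and k: "k \<in> labels" and x: "x \<in> foot k"
    and x1: "act (linv (label_letter k)) x \<in> foot l"
  obtain i k0 b where l': "l = (i, k0, b)" "i \<in> A" "k0 < num i" using l by (auto simp: labels_def)
  obtain j q c where k': "k = (j, q, c)" "j \<in> A" "q < num j" using k by (auto simp: labels_def)
  let ?x = "act (linv (label_letter k)) x"
  have "?x = dir (fst (e j)) (\<not> c) x" using k' by (simp add: act_def linv_def)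
  then have xq: "pts j q < ?x" "?x < pts j (Suc q)" "?x \<notin> foot (j, q, \<not> c)"
    using att_foot_pull[OF marked_e[OF k'(2)] orb_orbital[OF k'(2,3)], of x c] x k'
    by (auto simp: foot_def orb_def)
  show "label_letter k \<noteq> linv (label_letter l) \<and> nxt l (label_letter k) = Some k"
  proof (cases "i = j")
    case True
    have "k0 = q"
      using bumps_gap_unique[OF bumps_seq[OF l'(2)] l'(3), of q ?x] foot_orb[OF l'(2,3), of ?x b] x1 xq l' k' True
      by simp
    moreover from this have "b = c" using xq(3) x1 l' True by (cases "b = c") auto
    ultimately show ?thesis using l' k' True by (auto simp: linv_def nxt_def)
  next
    case False
    have s: "?x \<in> supt (fst (e j))" using bumps_supt_iff[OF bumps_seq[OF k'(2)]] xq k' by blast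
    have fg: "case gap i j (pt_idx i k0 b) of None \<Rightarrow> ?x \<notin> supt (fst (e j))
      | Some q \<Rightarrow> q < num j \<and> pts j q < ?x \<and> ?x < pts j (Suc q)"
      using foot_gap[OF l'(2) k'(2) False l'(3)] x1 l' by blast
    then obtain q' where q': "gap i j (pt_idx i k0 b) = Some q'" "q' < num j" "pts j q' < ?x" "?x < pts j (Suc q')"
      using s by (auto split: option.splits)
    then have "q' = q" using bumps_gap_unique[OF bumps_seq[OF k'(2)] q'(2) k'(3) q'(3,4) xq(1,2)] by simp
    then show ?thesis using q' l' k' False by (auto simp: linv_def nxt_def)
  qed
next
  fix l :: "'i label" assume "l \<in> labels"
  then obtain i k0 b where l': "l = (i, k0, b)" "i \<in> A" "k0 < num i" by (auto simp: labels_def)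
  show "\<exists>x\<in>foot l. act (linv (label_letter l)) x \<in> foot l"
    using att_foot_deep[OF marked_e[OF l'(2)] orb_orbital[OF l'(2,3)], of b] l'
    by (simp add: foot_def orb_def act_def linv_def)
  show "\<exists>x\<in>foot l. act (linv (label_letter l)) x \<notin> foot l"
    using att_foot_shallow[OF marked_e[OF l'(2)] orb_orbital[OF l'(2,3)], of b] l'
    by (simp add: foot_def orb_def act_def linv_def)
next
  fix a :: "'i letter" and y assume a: "fst a \<in> A" and y: "\<forall>l\<in>labels. y \<notin> foot l"
  obtain j c where jc: "a = (j, c)" by (cases a)
  show "act a y = y \<or> (\<exists>k\<in>labels. label_letter k = a \<and> act a y \<in> foot k)"
  proof (cases "y \<in> supt (fst (e j))")
    case True
    have j: "j \<in> A" using a jc by simp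
    obtain q where q: "q < num j" "pts j q < y" "y < pts j (Suc q)"
      using bumps_supt_iff[OF bumps_seq[OF j]] True by blast
    have "(j, q, \<not> c) \<in> labels" "(j, q, c) \<in> labels" using j q by (auto simp: labels_def)
    then show ?thesis using act_push[OF j q, of c] y jc by fastforce
  next
    case False
    then show ?thesis using dir_fix[OF homeo_e[OF a]] jc by (simp add: act_def)
  qed
qed

end

section \<open>Two standard sets with the same signature\<close>

text \<open>The number of outer bumps of i that contain transition points of other functions.\<close>
definition depth :: "'i set \<Rightarrow> ('i \<Rightarrow> 'i \<Rightarrow> bool) \<Rightarrow> ('i \<Rightarrow> 'i \<Rightarrow> nat) \<Rightarrow> 'i \<Rightarrow> nat" where
  "depth A prec w i = Max (insert 0 ((\<lambda>h. w h i) ` {h \<in> A. h \<noteq> i \<and> prec h i}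
     \<union> (\<lambda>j. w i j - 1) ` {j \<in> A. j \<noteq> i \<and> prec i j}))"

text \<open>The bound for a larger j is weaker by one because the count for i belongs to the pair
  with the outer layer of j removed and the roles exchanged.\<close>

lemma depth_ge:
  assumes "finite A"
  shows "h \<in> A \<Longrightarrow> h \<noteq> i \<Longrightarrow> prec h i \<Longrightarrow> w h i \<le> depth A prec w i"
    and "j \<in> A \<Longrightarrow> i \<noteq> j \<Longrightarrow> prec i j \<Longrightarrow> w i j \<le> depth A prec w i + 1"
proof -
  let ?S = "insert 0 ((\<lambda>h. w h i) ` {h \<in> A. h \<noteq> i \<and> prec h i} \<union> (\<lambda>j. w i j - 1) ` {j \<in> A. j \<noteq> i \<and> prec i j})"
  have fin: "finite ?S" using assms by simp
  show "w h i \<le> depth A prec w i" if "h \<in> A" "h \<noteq> i" "prec h i"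
    unfolding depth_def using that by (intro Max_ge[OF fin]) blast
  have "w i j - 1 \<le> depth A prec w i" if "j \<in> A" "i \<noteq> j" "prec i j"
    unfolding depth_def using that by (intro Max_ge[OF fin]) blast
  then show "w i j \<le> depth A prec w i + 1" if "j \<in> A" "i \<noteq> j" "prec i j"
    using that by fastforce
qed

lemma (in std_world) depth_le_num:
  assumes "i \<in> A" shows "depth A prec w i \<le> num i"
proof -
  have "w h i \<le> num i" if "h \<in> A" "h \<noteq> i" "prec h i" for h
    using pair_interlaced(2)[OF that(1) assms that(2,3)] .
  moreover have "w i j - 1 \<le> num i" if "j \<in> A" "j \<noteq> i" "prec i j" for j
    using pair_interlaced(3)[OF assms that(1) _ that(3)] that(2) by simp
  ultimately show ?thesis unfolding depth_def using finite_A by (subst Max_le_iff) auto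
qed

locale two_worlds =
  W1: std_world A e1 prec w + W2: std_world A e2 prec w
  for A :: "'i set" and e1 e2 prec w
begin

abbreviation "c \<equiv> depth A prec w"

definition core :: "'i \<Rightarrow> nat \<Rightarrow> bool" where
  "core i k \<longleftrightarrow> c i \<noteq> 0 \<and> c i div 2 \<le> k \<and> k < W1.num i - (c i + 1) div 2"

text \<open>The second alternative sends the inverse-letter feet of all inner bumps to one foot:
  that of the leftmost right-hand outer bump in the other set. \<open>core\<close> demands
  \<open>c i \<noteq> 0\<close>, which guarantees that this bump exists.\<close>

definition related :: "'i label \<Rightarrow> 'i label \<Rightarrow> bool" where
  "related l l' \<longleftrightarrow> (\<exists>i b k k'. l = (i, k, b) \<and> l' = (i, k', b)
     \<and> (bump_match (c i) (W1.num i) (W2.num i) k k'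
        \<or> core i k \<and> \<not> b \<and> k' = W2.num i - (c i + 1) div 2))"

definition special :: "'i label \<Rightarrow> bool" where
  "special l \<longleftrightarrow> (\<exists>i k. l = (i, k, True) \<and> core i k)"

lemma gap_match:
  assumes ij: "i \<in> A" "j \<in> A" "i \<noteq> j" and t: "pt_match (c i) (W1.num i) (W2.num i) t t'"
  shows "rel_option (bump_match (c j) (W1.num j) (W2.num j)) (W1.gap i j t) (W2.gap i j t')"
proof (cases "prec i j")
  case True
  then show ?thesis
    using loc_match[OF t, of "w i j" "c j" "W1.num j" "W2.num j"] depth_ge[OF W1.finite_A] ij
      W1.depth_le_num W2.depth_le_num
    by (simp add: W1.gap_def W2.gap_def)
next
  case False
  then have "prec j i" using W1.total ij by blast
  then show ?thesis
    using loc_outer_match[OF t, of "w j i" "c j" "W1.num j" "W2.num j"] depth_ge[OF W1.finite_A] ij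
      W1.depth_le_num W2.depth_le_num False
    by (simp add: W1.gap_def W2.gap_def)
qed

lemma nxt_related:
  assumes "i \<in> A" "j \<in> A" "i \<noteq> j" "pt_match (c i) (W1.num i) (W2.num i) (W1.pt_idx i k b) (W2.pt_idx i k' b')"
  shows "rel_option related (W1.nxt (i, k, b) (j, d)) (W2.nxt (i, k', b') (j, d))"
  using gap_match[OF assms(1-3), of "W1.pt_idx i k b" "W2.pt_idx i k' b'"] assms
  by (auto simp: W1.nxt_def W2.nxt_def related_def option.rel_map elim!: option.rel_mono_strong)

lemma half_sums:
  "i \<in> A \<Longrightarrow> c i div 2 + (c i + 1) div 2 = c i \<and> c i \<le> W1.num i \<and> c i \<le> W2.num i"
proof -
  assume "i \<in> A"
  moreover have "c i div 2 + (c i + 1) div 2 = c i" by linarith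
  ultimately show ?thesis using W1.depth_le_num W2.depth_le_num by blast
qed

text \<open>The partner bump is positive, so its foot for the inverse letter lies at its left end,
  and that end is the rightmost core point. Both end points of an inner bump are core points too,
  which is why the sign b is arbitrary.\<close>

lemma partner_pt:
  assumes "i \<in> A" "core i k"
  shows "pt_match (c i) (W1.num i) (W2.num i) (W1.pt_idx i k b)
    (W2.pt_idx i (W2.num i - (c i + 1) div 2) False)"
proof -
  have "W2.num i div 2 \<le> W2.num i - (c i + 1) div 2" using half_sums[OF assms(1)] by linarith
  then have "W2.pt_idx i (W2.num i - (c i + 1) div 2) False = W2.num i - (c i + 1) div 2"
    by (simp add: W2.pt_idx_def)
  moreover have "core_pt (c i) (W2.num i) (W2.num i - (c i + 1) div 2)"
    using half_sums[OF assms(1)] unfolding core_pt_def by linarith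
  moreover have "core_pt (c i) (W1.num i) (W1.pt_idx i k b)" "W1.pt_idx i k b \<le> W1.num i"
    using assms(2) by (auto simp: core_pt_def core_def W1.pt_idx_def)
  ultimately show ?thesis by (simp add: pt_match_def)
qed

text \<open>As the depth is at most the number of bumps on both sides, left outer bumps are negative
  and right outer bumps positive in both sets. Matched outer bumps thus carry the foot of a given
  letter at the same end. For depth 0 all points match, whatever the signs.\<close>

lemma related_pt:
  assumes "i \<in> A" "related (i, k, b) (i, k', b)"
  shows "pt_match (c i) (W1.num i) (W2.num i) (W1.pt_idx i k b) (W2.pt_idx i k' b)"
proof (cases "bump_match (c i) (W1.num i) (W2.num i) k k'")
  case True
  note h = half_sums[OF assms(1)]
  show ?thesis
  proof (cases "c i = 0")
    case True
    then show ?thesis using \<open>bump_match _ _ _ k k'\<close>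
      by (auto simp: pt_match_def bump_match_def W1.pt_idx_def W2.pt_idx_def)
  next
    case False
    have "(W1.num i div 2 \<le> k) = (W2.num i div 2 \<le> k')"
      using \<open>bump_match _ _ _ k k'\<close> False h unfolding bump_match_def
    proof (elim conjE disjE)
      assume "k = k'" "k < c i div 2"
      then have "\<not> W1.num i div 2 \<le> k" "\<not> W2.num i div 2 \<le> k'" using h by linarith+
      then show ?thesis by blast
    next
      assume "k < W1.num i" "k' < W2.num i" "W1.num i - k = W2.num i - k'" "W1.num i - k \<le> (c i + 1) div 2"
      then have "W1.num i div 2 \<le> k" "W2.num i div 2 \<le> k'" using h by linarith+
      then show ?thesis by blast
    qed simp
    then show ?thesis using bump_match_pts[OF \<open>bump_match _ _ _ k k'\<close>]
      by (auto simp: W1.pt_idx_def W2.pt_idx_def)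
  qed
next
  case False
  then have "core i k" "\<not> b" "k' = W2.num i - (c i + 1) div 2" using assms(2) by (auto simp: related_def)
  then show ?thesis using partner_pt[OF assms(1), of k b] by simp
qed

lemma partner_label: "i \<in> A \<Longrightarrow> core i k \<Longrightarrow> (i, W2.num i - (c i + 1) div 2, d) \<in> W2.labels"
  using W2.num_pos[of i] by (auto simp: W2.labels_def core_def)

lemma related_total:
  assumes "l \<in> W1.labels" "\<not> special l"
  shows "\<exists>l'\<in>W2.labels. related l l'"
proof -
  obtain i k b where l: "l = (i, k, b)" "i \<in> A" "k < W1.num i" using assms(1) by (auto simp: W1.labels_def)
  note h = half_sums[OF l(2)]
  consider "c i = 0" | "k < c i div 2" | "c i \<noteq> 0" "W1.num i - k \<le> (c i + 1) div 2" | "core i k"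
    unfolding core_def by linarith
  then show ?thesis
  proof cases
    case 1
    then have "related l (i, 0, b)" using l W2.num_pos by (auto simp: related_def bump_match_def)
    then show ?thesis using l W2.num_pos by (intro bexI[of _ "(i, 0, b)"]) (auto simp: W2.labels_def)
  next
    case 2
    then have "k < W2.num i" using h by linarith
    then have "related l (i, k, b)" using l 2 by (auto simp: related_def bump_match_def)
    then show ?thesis using l \<open>k < W2.num i\<close> by (intro bexI[of _ "(i, k, b)"]) (auto simp: W2.labels_def)
  next
    case 3
    define k' where "k' = W2.num i - (W1.num i - k)"
    have "k' < W2.num i" "W1.num i - k = W2.num i - k'" using l(3) 3 h unfolding k'_def by linarith+
    then have "related l (i, k', b)" using l 3 by (auto simp: related_def bump_match_def)
    then show ?thesis using l \<open>k' < W2.num i\<close> by (intro bexI[of _ "(i, k', b)"]) (auto simp: W2.labels_def)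
  next
    case 4
    then have "\<not> b" using assms(2) l by (auto simp: special_def)
    then have "related l (i, W2.num i - (c i + 1) div 2, b)" using 4 l by (auto simp: related_def)
    then show ?thesis using partner_label[OF l(2) 4, of b] by blast
  qed
qed

lemma word_transfer:
  assumes v: "W1.wf_word v" and triv: "\<And>x. word_act W2.act v x = x"
  shows "word_act W1.act v x = x"
proof -
  interpret T: transfer A W1.act W1.labels W1.foot label_letter W1.nxt
    W2.act W2.labels W2.foot label_letter W2.nxt related special
  proof unfold_locales
    fix l assume "l \<in> W1.labels" "\<not> special l"
    then show "\<exists>l'\<in>W2.labels. related l l'" by (rule related_total)
  next
    fix l l' assume "related l l'"
    then show "label_letter l' = label_letter l" by (auto simp: related_def)
  next
    fix l l' and a :: "'i letter"
    assume l: "l \<in> W1.labels" "l' \<in> W2.labels" "related l l'" and a: "fst a \<in> A" "a \<noteq> linv (label_letter l)"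
    then obtain i k k' b where ll: "l = (i, k, b)" "l' = (i, k', b)" by (auto simp: related_def)
    have i: "i \<in> A" using l ll by (auto simp: W1.labels_def)
    obtain j d where jd: "a = (j, d)" by (cases a)
    show "rel_option related (W1.nxt l a) (W2.nxt l' a)"
    proof (cases "i = j")
      case True
      then have "d = b" using a ll jd by (auto simp: linv_def)
      then show ?thesis using True l ll jd by (simp add: W1.nxt_def W2.nxt_def)
    next
      case False
      then show ?thesis using nxt_related[OF i _ False] related_pt[OF i] a l ll jd by simp
    qed
  next
    fix l assume l: "l \<in> W1.labels" "special l"
    then obtain i k where ik: "l = (i, k, True)" "core i k" "i \<in> A" by (auto simp: special_def W1.labels_def)
    define l' where "l' = (i, W2.num i - (c i + 1) div 2, False)"
    have "l' \<in> W2.labels" unfolding l'_def using partner_label[OF ik(3,2)] .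
    moreover have "rel_option related (W1.nxt l a) (W2.nxt l' a)"
      if "fst a \<in> A" "fst a \<noteq> fst (label_letter l)" for a
      using nxt_related[OF ik(3) that(1) _ partner_pt[OF ik(3,2), of True], of "snd a"] that ik
      by (simp add: l'_def)
    moreover have "label_letter l' = linv (label_letter l)" "W1.nxt l (label_letter l) = Some l"
      "W2.nxt l' (label_letter l') = Some l'"
      using ik by (simp_all add: l'_def linv_def W1.nxt_def W2.nxt_def)
    ultimately show "\<exists>l'\<in>W2.labels. label_letter l' = linv (label_letter l)
      \<and> W1.nxt l (label_letter l) = Some l \<and> W2.nxt l' (label_letter l') = Some l'
      \<and> (\<forall>a. fst a \<in> A \<and> fst a \<noteq> fst (label_letter l) \<longrightarrow> rel_option related (W1.nxt l a) (W2.nxt l' a))"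
      by blast
  qed
  show ?thesis using T.trivial_transfer[OF v] triv by blast
qed

end

section \<open>From trivial words to an isomorphism of the generated groups\<close>

definition word_inv :: "'g letter list \<Rightarrow> 'g letter list" where
  "word_inv v = rev (map linv v)"

context pingpong
begin

lemma wf_word_append [simp]: "wf_word (u @ v) \<longleftrightarrow> wf_word u \<and> wf_word v"
  by (auto simp: wf_word_def)

lemma wf_word_inv [simp]: "wf_word (word_inv v) \<longleftrightarrow> wf_word v"
  by (auto simp: wf_word_def word_inv_def)

lemma word_act_inv: "wf_word v \<Longrightarrow> word_act act (word_inv v) (word_act act v x) = x"
  by (induction v arbitrary: x) (auto simp: word_inv_def word_act_append)

lemma word_act_eq_iff_trivial:
  assumes "wf_word u" "wf_word v"
  shows "word_act act u = word_act act v \<longleftrightarrow> (\<forall>x. word_act act (u @ word_inv v) x = x)"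
proof -
  have "word_act act (u @ word_inv v) x = x \<longleftrightarrow> word_act act u x = word_act act v x" for x
    unfolding word_act_append
    using word_act_inv[OF assms(2), of x] word_act_eq_iff[of "word_inv v" "word_act act u x" "word_act act v x"] assms(2)
    by simp
  then show ?thesis by (simp add: fun_eq_iff)
qed

end

lemma Homeo_inv:
  assumes "homeo f" shows "inv\<^bsub>Homeo\<^esub> f = finv f"
  unfolding m_inv_def
proof (rule the_equality)
  note b = homeo_bij[OF assms]
  show "finv f \<in> carrier Homeo \<and> f \<otimes>\<^bsub>Homeo\<^esub> finv f = \<one>\<^bsub>Homeo\<^esub> \<and> finv f \<otimes>\<^bsub>Homeo\<^esub> f = \<one>\<^bsub>Homeo\<^esub>"
    using homeo_inv[OF assms] b by (auto simp: Homeo_def fun_eq_iff bij_is_inj bij_is_surj surj_f_inv_f)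
  fix g assume "g \<in> carrier Homeo \<and> f \<otimes>\<^bsub>Homeo\<^esub> g = \<one>\<^bsub>Homeo\<^esub> \<and> g \<otimes>\<^bsub>Homeo\<^esub> f = \<one>\<^bsub>Homeo\<^esub>"
  then have "g \<circ> f = id" by (simp add: Homeo_def)
  then have "g (f (finv f t)) = finv f t" for t by (metis comp_apply id_apply)
  then show "g = finv f" using b by (simp add: fun_eq_iff bij_is_surj surj_f_inv_f)
qed

lemma (in std_world) generate_eq_words:
  "generate Homeo ((\<lambda>i. fst (e i)) ` A) = {word_act act v |v. wf_word v}"
proof (intro subset_antisym subsetI)
  fix g assume "g \<in> generate Homeo ((\<lambda>i. fst (e i)) ` A)"
  then show "g \<in> {word_act act v |v. wf_word v}"
  proof (induction rule: generate.induct)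
    case one
    have "\<one>\<^bsub>Homeo\<^esub> = word_act act []" by (auto simp: Homeo_def)
    then show ?case by (intro CollectI exI[of _ "[]"]) simp
  next
    case (incl h)
    then obtain i where "i \<in> A" "h = fst (e i)" by blast
    then have "h = word_act act [(i, True)] \<and> wf_word [(i, True)]" by (auto simp: act_def dir_def)
    then show ?case by blast
  next
    case (inv h)
    then obtain i where i: "i \<in> A" "h = fst (e i)" by blast
    then have "inv\<^bsub>Homeo\<^esub> h = word_act act [(i, False)] \<and> wf_word [(i, False)]"
      using Homeo_inv[OF homeo_e[OF i(1)]] by (auto simp: act_def dir_def)
    then show ?case by blast
  next
    case (eng g h)
    then obtain u v where uv: "g = word_act act u" "wf_word u" "h = word_act act v" "wf_word v" by blast
    then have "g \<otimes>\<^bsub>Homeo\<^esub> h = word_act act (u @ v) \<and> wf_word (u @ v)"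
      by (auto simp: Homeo_def word_act_append)
    then show ?case by blast
  qed
next
  fix g assume "g \<in> {word_act act v |v. wf_word v}"
  then obtain v where "g = word_act act v" "wf_word v" by blast
  moreover have "word_act act v \<in> generate Homeo ((\<lambda>i. fst (e i)) ` A)" if "wf_word v" for v
    using that
  proof (induction v)
    case Nil
    have "word_act act [] = \<one>\<^bsub>Homeo\<^esub>" by (auto simp: Homeo_def)
    then show ?case by (simp add: generate.one)
  next
    case (Cons a v)
    obtain i b where a: "a = (i, b)" by (cases a)
    then have i: "i \<in> A" using Cons by simp
    have "act a \<in> generate Homeo ((\<lambda>i. fst (e i)) ` A)"
    proof (cases b)
      case True
      then show ?thesis using a i by (auto simp: act_def dir_def intro: generate.incl)
    next
      case False
      then have "act a = inv\<^bsub>Homeo\<^esub> (fst (e i))"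
        using Homeo_inv[OF homeo_e[OF i]] a by (simp add: act_def dir_def)
      then show ?thesis using i by (auto intro: generate.inv)
    qed
    moreover have "word_act act (a # v) = act a \<otimes>\<^bsub>Homeo\<^esub> word_act act v" by (auto simp: Homeo_def)
    ultimately show ?case using Cons by (auto intro: generate.eng)
  qed
  ultimately show "g \<in> generate Homeo ((\<lambda>i. fst (e i)) ` A)" by blast
qed

context two_worlds
begin

lemma word_eq_iff:
  assumes "W1.wf_word u" "W1.wf_word v"
  shows "word_act W1.act u = word_act W1.act v \<longleftrightarrow> word_act W2.act u = word_act W2.act v"
proof -
  \<comment> \<open>The transfer of trivial words goes one way only, since special labels are
    defined by the first set; the hypotheses are symmetric, so it is applied twice.\<close>
  interpret swap: two_worlds A e2 e1 prec w by unfold_locales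
  have wf: "W2.wf_word x \<longleftrightarrow> W1.wf_word x" for x by (simp add: W1.wf_word_def W2.wf_word_def)
  have "W1.wf_word (u @ word_inv v)" using assms by simp
  then have "(\<forall>x. word_act W1.act (u @ word_inv v) x = x) \<longleftrightarrow> (\<forall>x. word_act W2.act (u @ word_inv v) x = x)"
    using word_transfer[of "u @ word_inv v"] swap.word_transfer[of "u @ word_inv v"] wf by blast
  then show ?thesis
    using W1.word_act_eq_iff_trivial[OF assms] W2.word_act_eq_iff_trivial[of u v] wf assms by simp
qed

theorem generated_iso:
  "\<exists>\<phi>. \<phi> \<in> iso (Homeo\<lparr>carrier := generate Homeo ((\<lambda>i. fst (e1 i)) ` A)\<rparr>)
                (Homeo\<lparr>carrier := generate Homeo ((\<lambda>i. fst (e2 i)) ` A)\<rparr>)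
      \<and> (\<forall>i\<in>A. \<phi> (fst (e1 i)) = fst (e2 i))"
proof -
  have wf: "W2.wf_word x \<longleftrightarrow> W1.wf_word x" for x by (simp add: W1.wf_word_def W2.wf_word_def)
  \<comment> \<open>A word for g is chosen arbitrarily; by \<open>word_eq_iff\<close> its value in
    the second group does not depend on the choice.\<close>
  define \<phi> where "\<phi> g = word_act W2.act (SOME v. W1.wf_word v \<and> word_act W1.act v = g)" for g
  have \<phi>: "\<phi> (word_act W1.act v) = word_act W2.act v" if "W1.wf_word v" for v
  proof -
    let ?u = "SOME u. W1.wf_word u \<and> word_act W1.act u = word_act W1.act v"
    have "W1.wf_word ?u \<and> word_act W1.act ?u = word_act W1.act v" by (rule someI[of _ v]) (use that in simp)
    then show ?thesis using word_eq_iff that unfolding \<phi>_def by blast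
  qed
  have mult: "word_act act u \<otimes>\<^bsub>Homeo\<^esub> word_act act v = word_act act (u @ v)"
    for act :: "'i letter \<Rightarrow> real \<Rightarrow> real" and u v
    by (auto simp: Homeo_def word_act_append)
  have "\<phi> \<in> iso (Homeo\<lparr>carrier := generate Homeo ((\<lambda>i. fst (e1 i)) ` A)\<rparr>)
                (Homeo\<lparr>carrier := generate Homeo ((\<lambda>i. fst (e2 i)) ` A)\<rparr>)"
  proof (rule isoI)
    show "\<phi> \<in> hom (Homeo\<lparr>carrier := generate Homeo ((\<lambda>i. fst (e1 i)) ` A)\<rparr>)
                (Homeo\<lparr>carrier := generate Homeo ((\<lambda>i. fst (e2 i)) ` A)\<rparr>)"
      unfolding W1.generate_eq_words W2.generate_eq_words
    proof (rule homI)
      fix g assume "g \<in> carrier (Homeo\<lparr>carrier := {word_act W1.act v |v. W1.wf_word v}\<rparr>)"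
      then show "\<phi> g \<in> carrier (Homeo\<lparr>carrier := {word_act W2.act v |v. W2.wf_word v}\<rparr>)"
        using \<phi> wf by auto
    next
      fix g h
      assume "g \<in> carrier (Homeo\<lparr>carrier := {word_act W1.act v |v. W1.wf_word v}\<rparr>)"
        "h \<in> carrier (Homeo\<lparr>carrier := {word_act W1.act v |v. W1.wf_word v}\<rparr>)"
      then obtain u v where "g = word_act W1.act u" "W1.wf_word u" "h = word_act W1.act v" "W1.wf_word v"
        by auto
      then show "\<phi> (g \<otimes>\<^bsub>Homeo\<lparr>carrier := {word_act W1.act v |v. W1.wf_word v}\<rparr>\<^esub> h)
        = \<phi> g \<otimes>\<^bsub>Homeo\<lparr>carrier := {word_act W2.act v |v. W2.wf_word v}\<rparr>\<^esub> \<phi> h"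
        using \<phi>[of "u @ v"] \<phi>[of u] \<phi>[of v] by (simp add: mult)
    qed
    have "inj_on \<phi> {word_act W1.act v |v. W1.wf_word v}"
    proof (rule inj_onI)
      fix g h assume "g \<in> {word_act W1.act v |v. W1.wf_word v}" "h \<in> {word_act W1.act v |v. W1.wf_word v}"
        "\<phi> g = \<phi> h"
      then show "g = h" using \<phi> word_eq_iff by auto
    qed
    moreover have "\<phi> ` {word_act W1.act v |v. W1.wf_word v} = {word_act W2.act v |v. W2.wf_word v}"
    proof (intro subset_antisym subsetI)
      fix g assume "g \<in> {word_act W2.act v |v. W2.wf_word v}"
      then obtain v where "g = \<phi> (word_act W1.act v)" "W1.wf_word v" using \<phi> wf by auto
      then show "g \<in> \<phi> ` {word_act W1.act v |v. W1.wf_word v}" by blast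
    qed (use \<phi> wf in auto)
    ultimately show "bij_betw \<phi> (carrier (Homeo\<lparr>carrier := generate Homeo ((\<lambda>i. fst (e1 i)) ` A)\<rparr>))
      (carrier (Homeo\<lparr>carrier := generate Homeo ((\<lambda>i. fst (e2 i)) ` A)\<rparr>))"
      unfolding W1.generate_eq_words W2.generate_eq_words bij_betw_def by simp
  qed
  moreover have "\<phi> (fst (e1 i)) = fst (e2 i)" if "i \<in> A" for i
  proof -
    have "word_act W1.act [(i, True)] = fst (e1 i)" "word_act W2.act [(i, True)] = fst (e2 i)"
      by (auto simp: W1.act_def W2.act_def dir_def)
    then show ?thesis using \<phi>[of "[(i, True)]"] that by simp
  qed
  ultimately show ?thesis by blast
qed

end

theorem theorem1p3:
  fixes A B :: "mfun set" and \<theta> :: "mfun \<Rightarrow> mfun"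
  assumes "A \<in> std_sets" and "B \<in> std_sets"
    and "bij_betw \<theta> A B"
    and "\<forall>F\<in>A. \<forall>G\<in>A. lt F G \<longleftrightarrow> lt (\<theta> F) (\<theta> G)"
    and "\<forall>F\<in>A. \<forall>G\<in>A. lt F G \<longrightarrow> osc (\<theta> F) (\<theta> G) = osc F G"
  shows "\<exists>\<phi>. \<phi> \<in> iso (Homeo\<lparr>carrier := generate Homeo (fst ` A)\<rparr>)
                     (Homeo\<lparr>carrier := generate Homeo (fst ` B)\<rparr>)
             \<and> (\<forall>F\<in>A. \<phi> (fst F) = fst (\<theta> F))"
proof -
  have B: "\<theta> F \<in> B" if "F \<in> A" for F using assms(3) that by (auto simp: bij_betw_def)
  have ne: "\<theta> F \<noteq> \<theta> G" if "F \<in> A" "G \<in> A" "F \<noteq> G" for F G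
    using assms(3) that by (auto simp: bij_betw_def inj_on_def)
  \<comment> \<open>A itself is the index set, and both sets use the order and the oscillations of
    A; the assumptions on \<open>\<theta>\<close> transport these to B.\<close>
  interpret two_worlds A "\<lambda>F. F" \<theta> lt osc
  proof unfold_locales
    fix F G assume FG: "F \<in> A" "G \<in> A" "F \<noteq> G" "lt F G"
    then have "lt (\<theta> F) (\<theta> G)" using assms(4) by blast
    then show "std_pair (\<theta> F) (\<theta> G)"
      using assms(2) B FG ne[OF FG(1-3)] unfolding std_sets_def by blast
  qed (use assms(1,2,5) B in \<open>auto simp: std_sets_def\<close>)
  have "\<theta> ` A = B" using assms(3) by (simp add: bij_betw_def)
  then have "(\<lambda>F. fst (\<theta> F)) ` A = fst ` B" by (metis image_image)
  then show ?thesis using generated_iso by simp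
qed

end
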